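(* Let $\{X_n, n\ge1\}$ be a $\varphi$-mixing sequence of identically distributed random variables with common distribution function $F$, whose mixing coefficients satisfy $$\sum_{n\ge1}\varphi^{1/2}(2^n)<\infty .$$ Let $h:\mathbb{R}\to\mathbb{R}$ be measurable, and for each $n$ let $c_{n1},\dots,c_{nn}$ be real constants. Define $$L_n=\frac1n\sum_{i=1}^n c_{ni}\,h(X_{n:i}),$$ where $X_{n:1}\le\dots\le X_{n:n}$ are the order statistics of $X_1,\dots,X_n$. Let $F^{-1}(t)=\inf\{x:F(x)\ge t\}$, $H(t)=h(F^{-1}(t))$, let $c_n(t)=c_{ni}$ for $t\in((i-1)/n,i/n]$, $i=1,\dots,n$, $c_n(0)=c_{n1}$, and $$\mu_n=\int_0^1 c_n(t)H(t)\,dt .$$ For $1\le q<\infty$ put $C_n(q)=n^{-1}\sum_{i=1}^n|c_{ni}|^q$, and $C_n(\infty)=\max_{i\le n}|c_{ni}|$. Suppose that one of the following conditions holds: (i) $H$ is continuous on $[0,1]$ and $\sup_{n\ge1}C_n(1)<\infty$; (ii) for some $1\le p<\infty$, $\mathbf{E}|h(X_1)|^p<\infty$ and $\sup_{n\ge1}C_n(q)<\infty$, where $1/p+1/q=1$ (so $q=\infty$ when $p=1$). Then $L_n-\mu_n\to0$ almost surely as $n\to\infty$.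
   Context: The $\varphi$-mixing coefficients are $$\varphi(n)=\sup_{k\ge1}\sup\{|\mathbf{P}(B\mid A)-\mathbf{P}(B)| : A\in\mathcal{F}_1^k,\ B\in\mathcal{F}_{k+n}^\infty,\ \mathbf{P}(A)>0\},$$ where $\mathcal{F}_1^k$ and $\mathcal{F}_{k+n}^\infty$ are the $\sigma$-fields generated by $\{X_i,1\le i\le k\}$ and $\{X_i, i\ge k+n\}$ respectively; the sequence is $\varphi$-mixing if $\varphi(n)\to0$. Stationarity is not assumed. In condition (i), "$H$ is continuous on $[0,1]$" means that $H$ (defined by $h(F^{-1}(t))$ for $t\in(0,1)$) is, or extends to, a continuous function on $[0,1]$. *)

theory Defs
  imports "HOL-Probability.Probability"
begin

definition gen_sets :: "'a measure \<Rightarrow> (nat \<Rightarrow> 'a \<Rightarrow> real) \<Rightarrow> nat set \<Rightarrow> 'a set set" where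
  "gen_sets M X I = sigma_sets (space M) (\<Union>i\<in>I. {X i -` B \<inter> space M | B. B \<in> sets borel})"

definition phi_mix :: "'a measure \<Rightarrow> (nat \<Rightarrow> 'a \<Rightarrow> real) \<Rightarrow> nat \<Rightarrow> real" where
  "phi_mix M X n = Sup {\<bar>measure M (A \<inter> B) / measure M A - measure M B\<bar> | k A B.
      k \<ge> 1 \<and> A \<in> gen_sets M X {1..k} \<and> B \<in> gen_sets M X {k+n..} \<and> measure M A > 0}"

definition ord_stat :: "(nat \<Rightarrow> 'a \<Rightarrow> real) \<Rightarrow> nat \<Rightarrow> nat \<Rightarrow> 'a \<Rightarrow> real" where
  "ord_stat X n i w = sort (map (\<lambda>j. X j w) [1..<n+1]) ! (i - 1)"

definition L_stat :: "(nat \<Rightarrow> nat \<Rightarrow> real) \<Rightarrow> (real \<Rightarrow> real) \<Rightarrow> (nat \<Rightarrow> 'a \<Rightarrow> real) \<Rightarrow> nat \<Rightarrow> 'a \<Rightarrow> real" where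
  "L_stat c h X n w = (1 / real n) * (\<Sum>i=1..n. c n i * h (ord_stat X n i w))"

definition quantile :: "(real \<Rightarrow> real) \<Rightarrow> real \<Rightarrow> real" where
  "quantile F t = Inf {x. F x \<ge> t}"

text \<open>Step function c_n(t): c_{ni} on ((i-1)/n, i/n], and c_n(0) = c_{n1}.\<close>
definition c_step :: "(nat \<Rightarrow> nat \<Rightarrow> real) \<Rightarrow> nat \<Rightarrow> real \<Rightarrow> real" where
  "c_step c n t = (if t = 0 then c n 1 else c n (nat \<lceil>t * real n\<rceil>))"

definition C_q :: "(nat \<Rightarrow> nat \<Rightarrow> real) \<Rightarrow> real \<Rightarrow> nat \<Rightarrow> real" where
  "C_q c q n = (\<Sum>i=1..n. \<bar>c n i\<bar> powr q) / real n"

definition C_inf :: "(nat \<Rightarrow> nat \<Rightarrow> real) \<Rightarrow> nat \<Rightarrow> real" where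
  "C_inf c n = Max ((\<lambda>i. \<bar>c n i\<bar>) ` {1..n})"

end

theory Submission
  imports Defs
begin

text \<open>The L-statistic minus its centring is the integral over (0,1) of c_n times h(F_n^{-1}) - h(F^{-1}),
  where F_n^{-1} is the empirical quantile function, so it suffices to make the second factor small,
  uniformly in case (i) and in the p-norm in case (ii). In case (i) this is a Glivenko-Cantelli
  argument on a finite grid of quantiles. In case (ii) h is approximated in the p-norm of the common
  law by a bounded continuous g; the error h - g is controlled by the law of large numbers
  for |h - g|^p (X_i), and g(F_n^{-1}) tends to g(F^{-1}) almost everywhere.

  Both cases rest on the strong law for integrable functions of a single X_i. Its key
  ingredient is that the variance of a sum of n centred terms is O(n) times the
  maximal variance: comparing a block of length 2n with two blocks of length n separated by a gap
  of length about n^{1/4} multiplies the normalised 2-norm by a factor 1 + phi(gap)^{1/2}, and the product of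
  these factors over dyadic n converges by the summability assumption. Truncating at level n on
  a sparse set of n, Chebyshev and Borel-Cantelli then give the strong law along that set, and monotonicity of the
  partial sums fills the gaps.\<close>

section \<open>Covariance inequality for mixing sequences\<close>

text \<open>The variance bound may use phi at powers of two only. Doubling a block of length 2^j
  therefore takes the gap 2^(1 + j div 4): the exponents run through 1, 2, ... with each repeated
  four times, so the product of the factors stays bounded, while the gap is small against the scale
  2^(j/2) of the standard deviation, so that even a crude estimate of it leaves a summable error.
  Stationarity is not assumed, hence all block estimates are uniform in the starting index.

  A variance of order n is too weak for Borel-Cantelli along all n, and along powers of two alone
  monotonicity would lose a factor 2. Hence the lengths r * 2^i for every fixed r: for large r the
  neighbours r and r + 1 are close in ratio.

  In case (i), h itself may be discontinuous and the empirical quantiles need not converge at jumps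
  of F^{-1}. What is estimated instead is a parameter s at which the continuous version of h(F^{-1})
  takes the value of h at the order statistic.\<close>

lemma sum_square_le_card:
  fixes f :: "'b \<Rightarrow> real"
  assumes "finite I"
  shows "(\<Sum>i\<in>I. f i)\<^sup>2 \<le> card I * (\<Sum>i\<in>I. (f i)\<^sup>2)"
  using Cauchy_Schwarz_ineq_sum[of "\<lambda>_. 1" f I] by simp

text \<open>Packages \<open>gen_sets\<close> as a measure space, so that measurability of sums and
  compositions with respect to past and future can be automated; only its space and its sets
  matter.\<close>

definition gen_alg :: "'a measure \<Rightarrow> (nat \<Rightarrow> 'a \<Rightarrow> real) \<Rightarrow> nat set \<Rightarrow> 'a measure" where
  "gen_alg M X I = sigma (space M) (\<Union>i\<in>I. {X i -` B \<inter> space M | B. B \<in> sets borel})"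

lemma space_gen_alg [simp]: "space (gen_alg M X I) = space M"
  by (auto simp: gen_alg_def space_measure_of_conv)

lemma sets_gen_alg: "sets (gen_alg M X I) = gen_sets M X I"
  unfolding gen_alg_def gen_sets_def by (rule sets_measure_of) auto

lemma measurable_gen_alg:
  assumes "i \<in> I"
  shows "X i \<in> borel_measurable (gen_alg M X I)"
proof (rule measurableI)
  fix B :: "real set" assume "B \<in> sets borel"
  then show "X i -` B \<inter> space (gen_alg M X I) \<in> sets (gen_alg M X I)"
    using assms unfolding sets_gen_alg gen_sets_def by (auto intro!: sigma_sets.Basic)
qed simp

lemma gen_sets_mono: "I \<subseteq> J \<Longrightarrow> gen_sets M X I \<subseteq> gen_sets M X J"
  unfolding gen_sets_def by (intro sigma_sets_mono') auto

lemma measurable_gen_alg_mono: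
  assumes "f \<in> borel_measurable (gen_alg M X I)" "I \<subseteq> J"
  shows "f \<in> borel_measurable (gen_alg M X J)"
  using assms(1) subsetD[OF gen_sets_mono[OF assms(2)]] unfolding measurable_def sets_gen_alg by auto

text \<open>Values may lie in any type and only the fibres need to be measurable: the lemma is
  applied to real variables, to pairs for a joint expectation, and to the index function
  \<open>cell\<close> on the unit interval.\<close>

lemma (in prob_space) expectation_finite_range:
  fixes f :: "'b \<Rightarrow> real" and \<xi> :: "'a \<Rightarrow> 'b"
  assumes "finite I" "\<xi> ` space M \<subseteq> I" "\<And>x. x \<in> I \<Longrightarrow> \<xi> -` {x} \<inter> space M \<in> sets M"
  shows "expectation (\<lambda>w. f (\<xi> w)) = (\<Sum>x\<in>I. f x * measure M (\<xi> -` {x} \<inter> space M))"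
proof -
  have "expectation (\<lambda>w. f (\<xi> w)) = expectation (\<lambda>w. \<Sum>x\<in>I. f x * indicator (\<xi> -` {x} \<inter> space M) w)"
  proof (rule Bochner_Integration.integral_cong[OF refl])
    fix w assume w: "w \<in> space M"
    then have "(\<Sum>x\<in>I. f x * indicator (\<xi> -` {x} \<inter> space M) w) = (\<Sum>x\<in>I. if \<xi> w = x then f x else 0)"
      by (intro sum.cong) (auto simp: indicator_def)
    then show "f (\<xi> w) = (\<Sum>x\<in>I. f x * indicator (\<xi> -` {x} \<inter> space M) w)"
      using assms(1,2) w by (auto simp: sum.delta')
  qed
  also have "\<dots> = (\<Sum>x\<in>I. f x * measure M (\<xi> -` {x} \<inter> space M))"
    using assms(3) by (subst Bochner_Integration.integral_sum) (auto simp: less_top[symmetric])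
  finally show ?thesis .
qed

locale rv_sequence = prob_space M for M :: "'a measure" +
  fixes X :: "nat \<Rightarrow> 'a \<Rightarrow> real"
  assumes rv: "i \<ge> 1 \<Longrightarrow> X i \<in> borel_measurable M"
begin

lemma gen_sets_subset:
  assumes "0 \<notin> I"
  shows "gen_sets M X I \<subseteq> sets M"
proof -
  have "X i -` B \<inter> space M \<in> sets M" if "i \<in> I" "B \<in> sets borel" for i B
    using rv[of i] that assms by (cases i) (auto intro: measurable_sets)
  then show ?thesis
    unfolding gen_sets_def by (intro sets.sigma_sets_subset) auto
qed

lemma measurable_from_gen_alg:
  assumes "f \<in> borel_measurable (gen_alg M X I)" "0 \<notin> I"
  shows "f \<in> borel_measurable M"
  using assms(1) gen_sets_subset[OF assms(2)] unfolding measurable_def sets_gen_alg by auto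

text \<open>\<open>Sup\<close> of a set of reals is informative only if the set is bounded; here
  both probabilities lie in [0,1].\<close>

lemma phi_mix_bdd_above:
  "bdd_above {\<bar>measure M (A \<inter> B) / measure M A - measure M B\<bar> | k A B.
      k \<ge> 1 \<and> A \<in> gen_sets M X {1..k} \<and> B \<in> gen_sets M X {k+n..} \<and> measure M A > 0}"
proof (rule bdd_aboveI, safe)
  fix k :: nat and A B assume k: "k \<ge> 1" and A: "A \<in> gen_sets M X {1..k}"
    and B: "B \<in> gen_sets M X {k+n..}" and pos: "measure M A > 0"
  have "A \<in> sets M" using gen_sets_subset[of "{1..k}"] A by auto
  then have "measure M (A \<inter> B) \<le> measure M A"
    by (intro finite_measure_mono) auto
  then have "measure M (A \<inter> B) / measure M A \<le> 1" "0 \<le> measure M (A \<inter> B) / measure M A"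
    using pos by (auto simp: divide_simps)
  moreover have "0 \<le> measure M B" "measure M B \<le> 1" by auto
  ultimately show "\<bar>measure M (A \<inter> B) / measure M A - measure M B\<bar> \<le> 1"
    by linarith
qed

text \<open>Multiplying by the probability of \<open>A\<close> removes the restriction to events of
  positive probability, since a null event makes both sides vanish.\<close>

lemma phi_mix_dependence:
  assumes "k \<ge> 1" "A \<in> gen_sets M X {1..k}" "B \<in> gen_sets M X {k+n..}"
  shows "\<bar>measure M (A \<inter> B) - measure M A * measure M B\<bar> \<le> phi_mix M X n * measure M A"
proof (cases "measure M A > 0")
  case True
  have "\<bar>measure M (A \<inter> B) / measure M A - measure M B\<bar> \<le> phi_mix M X n"
    unfolding phi_mix_def by (rule cSup_upper[OF _ phi_mix_bdd_above]) (use assms True in blast)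
  moreover have "measure M (A \<inter> B) - measure M A * measure M B
      = (measure M (A \<inter> B) / measure M A - measure M B) * measure M A"
    using True by (simp add: field_simps)
  ultimately show ?thesis
    by (simp add: abs_mult mult_right_mono)
next
  case False
  then have A0: "measure M A = 0" by (simp add: zero_less_measure_iff)
  have "A \<in> sets M" using gen_sets_subset[of "{1..k}"] assms by auto
  then have "measure M (A \<inter> B) \<le> measure M A"
    by (intro finite_measure_mono) auto
  then have "measure M (A \<inter> B) = 0"
    using A0 measure_nonneg[of M "A \<inter> B"] by linarith
  then show ?thesis by (simp add: A0)
qed

lemma phi_mix_nonneg: "0 \<le> phi_mix M X n"
proof -
  have "space M \<in> gen_sets M X I" for I
    unfolding gen_sets_def by (rule sigma_sets_top)
  from phi_mix_dependence[OF _ this this, of 1 n] show ?thesis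
    by (simp add: prob_space)
qed

text \<open>Split the values y by the sign of the difference. The fibres over each part form one
  event of the future, so each part contributes at most phi times the probability of
  \<open>A\<close>; the two signs give the factor 2.\<close>

lemma sum_abs_dependence:
  fixes \<eta> :: "'a \<Rightarrow> real"
  assumes k: "k \<ge> 1" and A: "A \<in> gen_sets M X {1..k}"
    and \<eta>: "\<eta> \<in> borel_measurable (gen_alg M X {k+n..})" and J: "finite J"
  shows "(\<Sum>y\<in>J. \<bar>measure M (A \<inter> (\<eta> -` {y} \<inter> space M)) - measure M A * measure M (\<eta> -` {y} \<inter> space M)\<bar>)
      \<le> 2 * phi_mix M X n * measure M A"
proof -
  have AM: "A \<in> sets M" using gen_sets_subset[of "{1..k}"] A by auto
  have \<eta>M: "\<eta> \<in> borel_measurable M"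
    by (rule measurable_from_gen_alg[OF \<eta>]) (use k in auto)
  define D where "D y = measure M (A \<inter> (\<eta> -` {y} \<inter> space M)) - measure M A * measure M (\<eta> -` {y} \<inter> space M)" for y
  have part: "\<bar>\<Sum>y\<in>L. D y\<bar> \<le> phi_mix M X n * measure M A" if L: "finite L" for L
  proof -
    have s: "\<eta> -` {y} \<inter> space M \<in> sets M" for y
      using \<eta>M by (auto intro: measurable_sets)
    have "(\<Sum>y\<in>L. measure M (A \<inter> (\<eta> -` {y} \<inter> space M))) = measure M (\<Union>y\<in>L. A \<inter> (\<eta> -` {y} \<inter> space M))"
      by (rule finite_measure_finite_Union[symmetric]) (use L AM s in \<open>auto simp: disjoint_family_on_def\<close>)
    also have "(\<Union>y\<in>L. A \<inter> (\<eta> -` {y} \<inter> space M)) = A \<inter> (\<eta> -` L \<inter> space M)" by auto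
    finally have 1: "(\<Sum>y\<in>L. measure M (A \<inter> (\<eta> -` {y} \<inter> space M))) = measure M (A \<inter> (\<eta> -` L \<inter> space M))" .
    have "(\<Sum>y\<in>L. measure M (\<eta> -` {y} \<inter> space M)) = measure M (\<Union>y\<in>L. \<eta> -` {y} \<inter> space M)"
      by (rule finite_measure_finite_Union[symmetric]) (use L s in \<open>auto simp: disjoint_family_on_def\<close>)
    also have "(\<Union>y\<in>L. \<eta> -` {y} \<inter> space M) = \<eta> -` L \<inter> space M" by auto
    finally have 2: "(\<Sum>y\<in>L. measure M (\<eta> -` {y} \<inter> space M)) = measure M (\<eta> -` L \<inter> space M)" .
    have "L \<in> sets borel" using L by (simp add: finite_imp_closed borel_closed)
    then have B: "\<eta> -` L \<inter> space M \<in> gen_sets M X {k+n..}"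
      using measurable_sets[OF \<eta>, of L] by (simp add: sets_gen_alg)
    have "(\<Sum>y\<in>L. D y) = measure M (A \<inter> (\<eta> -` L \<inter> space M)) - measure M A * measure M (\<eta> -` L \<inter> space M)"
      unfolding D_def sum_subtractf 1 sum_distrib_left[symmetric] 2 ..
    then show ?thesis
      using phi_mix_dependence[OF k A B] by simp
  qed
  have "(\<Sum>y\<in>J. \<bar>D y\<bar>) = (\<Sum>y\<in>J \<inter> {y. D y \<ge> 0}. \<bar>D y\<bar>) + (\<Sum>y\<in>J - {y. D y \<ge> 0}. \<bar>D y\<bar>)"
    by (rule sum.Int_Diff[OF J])
  also have "(\<Sum>y\<in>J \<inter> {y. D y \<ge> 0}. \<bar>D y\<bar>) = (\<Sum>y\<in>J \<inter> {y. D y \<ge> 0}. D y)"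
    by (rule sum.cong) auto
  also have "(\<Sum>y\<in>J - {y. D y \<ge> 0}. \<bar>D y\<bar>) = - (\<Sum>y\<in>J - {y. D y \<ge> 0}. D y)"
    unfolding sum_negf[symmetric] by (rule sum.cong) auto
  finally have "(\<Sum>y\<in>J. \<bar>D y\<bar>) \<le> 2 * phi_mix M X n * measure M A"
    using part[of "J \<inter> {y. D y \<ge> 0}"] part[of "J - {y. D y \<ge> 0}"] J by auto
  then show ?thesis unfolding D_def .
qed

text \<open>Cauchy-Schwarz with weights |D|: the column sums of the weights are controlled by the
  mixing coefficient, the row sums trivially.\<close>
lemma covariance_bound_finite_range:
  fixes \<xi> \<eta> :: "'a \<Rightarrow> real"
  assumes k: "k \<ge> 1" and \<xi>: "\<xi> \<in> borel_measurable (gen_alg M X {1..k})" "finite (\<xi> ` space M)"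
    and \<eta>: "\<eta> \<in> borel_measurable (gen_alg M X {k+n..})" "finite (\<eta> ` space M)"
  shows "(expectation (\<lambda>w. \<xi> w * \<eta> w) - expectation \<xi> * expectation \<eta>)\<^sup>2
      \<le> 4 * phi_mix M X n * expectation (\<lambda>w. (\<xi> w)\<^sup>2) * expectation (\<lambda>w. (\<eta> w)\<^sup>2)"
proof -
  define I J where "I = \<xi> ` space M" and "J = \<eta> ` space M"
  define A B where "A x = \<xi> -` {x} \<inter> space M" and "B y = \<eta> -` {y} \<inter> space M" for x y
  define D where "D x y = measure M (A x \<inter> B y) - measure M (A x) * measure M (B y)" for x y
  have fin: "finite I" "finite J" using \<xi> \<eta> by (auto simp: I_def J_def)
  have [measurable]: "\<xi> \<in> borel_measurable M" "\<eta> \<in> borel_measurable M"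
    using measurable_from_gen_alg[OF \<xi>(1)] measurable_from_gen_alg[OF \<eta>(1)] k by auto
  have AM: "A x \<in> sets M" and BM: "B x \<in> sets M" for x by (auto simp: A_def B_def)
  have Ag: "A x \<in> gen_sets M X {1..k}" for x
    using measurable_sets[OF \<xi>(1), of "{x}"] by (simp add: sets_gen_alg A_def)
  have e\<xi>: "expectation (\<lambda>w. f (\<xi> w)) = (\<Sum>x\<in>I. f x * measure M (A x))" for f :: "real \<Rightarrow> real"
    unfolding A_def by (rule expectation_finite_range) (use fin AM in \<open>auto simp: I_def A_def\<close>)
  have e\<eta>: "expectation (\<lambda>w. f (\<eta> w)) = (\<Sum>x\<in>J. f x * measure M (B x))" for f :: "real \<Rightarrow> real"
    unfolding B_def by (rule expectation_finite_range) (use fin BM in \<open>auto simp: J_def B_def\<close>)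
  have eq: "(\<lambda>w. (\<xi> w, \<eta> w)) -` {(x, y)} \<inter> space M = A x \<inter> B y" for x y
    by (auto simp: A_def B_def)
  have "expectation (\<lambda>w. \<xi> w * \<eta> w) = expectation (\<lambda>w. (\<lambda>z. fst z * snd z) (\<xi> w, \<eta> w))"
    by simp
  also have "\<dots> = (\<Sum>z\<in>I \<times> J. (fst z * snd z) * measure M ((\<lambda>w. (\<xi> w, \<eta> w)) -` {z} \<inter> space M))"
    by (rule expectation_finite_range) (use fin AM BM eq in \<open>auto simp: I_def J_def\<close>)
  also have "\<dots> = (\<Sum>(x,y)\<in>I \<times> J. x * y * measure M (A x \<inter> B y))"
    by (rule sum.cong) (auto simp: eq)
  finally have e\<xi>\<eta>: "expectation (\<lambda>w. \<xi> w * \<eta> w) = (\<Sum>(x,y)\<in>I \<times> J. x * y * measure M (A x \<inter> B y))" .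
  have "expectation (\<lambda>w. \<xi> w * \<eta> w) - expectation \<xi> * expectation \<eta> = (\<Sum>(x,y)\<in>I \<times> J. x * y * D x y)"
    unfolding e\<xi>\<eta> e\<xi>[of "\<lambda>x. x"] e\<eta>[of "\<lambda>x. x"] sum_product sum.cartesian_product sum_subtractf[symmetric]
    by (rule sum.cong) (auto simp: D_def algebra_simps)
  \<comment> \<open>Half of the weight goes to each factor; the sign of D is attached to the second
    one and disappears on squaring.\<close>
  also have "\<dots> = (\<Sum>z\<in>I \<times> J. (fst z * sqrt \<bar>D (fst z) (snd z)\<bar>) * (snd z * sgn (D (fst z) (snd z)) * sqrt \<bar>D (fst z) (snd z)\<bar>))"
  proof (rule sum.cong[OF refl], safe)
    fix x y
    have "x * y * D x y = x * y * (sgn (D x y) * (sqrt \<bar>D x y\<bar> * sqrt \<bar>D x y\<bar>))"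
      by (simp add: sgn_mult_abs)
    then show "x * y * D x y = fst (x, y) * sqrt \<bar>D (fst (x, y)) (snd (x, y))\<bar> *
       (snd (x, y) * sgn (D (fst (x, y)) (snd (x, y))) * sqrt \<bar>D (fst (x, y)) (snd (x, y))\<bar>)"
      by (simp only: fst_conv snd_conv mult_ac)
  qed
  finally have "(expectation (\<lambda>w. \<xi> w * \<eta> w) - expectation \<xi> * expectation \<eta>)\<^sup>2
     \<le> (\<Sum>z\<in>I \<times> J. (fst z * sqrt \<bar>D (fst z) (snd z)\<bar>)\<^sup>2)
       * (\<Sum>z\<in>I \<times> J. (snd z * sgn (D (fst z) (snd z)) * sqrt \<bar>D (fst z) (snd z)\<bar>)\<^sup>2)"
    by (simp only: Cauchy_Schwarz_ineq_sum)
  also have "(\<Sum>z\<in>I \<times> J. (fst z * sqrt \<bar>D (fst z) (snd z)\<bar>)\<^sup>2) = (\<Sum>x\<in>I. x\<^sup>2 * (\<Sum>y\<in>J. \<bar>D x y\<bar>))"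
    by (simp add: sum.cartesian_product' power_mult_distrib sum_distrib_left)
  also have "(\<Sum>z\<in>I \<times> J. (snd z * sgn (D (fst z) (snd z)) * sqrt \<bar>D (fst z) (snd z)\<bar>)\<^sup>2)
     = (\<Sum>(x,y)\<in>I \<times> J. y\<^sup>2 * \<bar>D x y\<bar>)"
  proof (rule sum.cong[OF refl], safe)
    fix x y
    show "(snd (x, y) * sgn (D (fst (x, y)) (snd (x, y))) * sqrt \<bar>D (fst (x, y)) (snd (x, y))\<bar>)\<^sup>2
       = y\<^sup>2 * \<bar>D x y\<bar>"
      by (simp add: power_mult_distrib sgn_if)
  qed
  also have "\<dots> = (\<Sum>y\<in>J. y\<^sup>2 * (\<Sum>x\<in>I. \<bar>D x y\<bar>))"
    unfolding sum.cartesian_product[symmetric] by (subst sum.swap) (simp add: sum_distrib_left)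
  \<comment> \<open>Fixing the past value x gains phi, because phi conditions on the past. Fixing
    the future value y only compares two families of total mass \<open>measure M (B y)\<close>. The
    product of the constants is 4 phi, so the covariance itself is controlled by the square root of
    phi, as in the summability assumption.\<close>
  also have "(\<Sum>x\<in>I. x\<^sup>2 * (\<Sum>y\<in>J. \<bar>D x y\<bar>)) * (\<Sum>y\<in>J. y\<^sup>2 * (\<Sum>x\<in>I. \<bar>D x y\<bar>))
     \<le> (\<Sum>x\<in>I. x\<^sup>2 * (2 * phi_mix M X n * measure M (A x))) * (\<Sum>y\<in>J. y\<^sup>2 * (2 * measure M (B y)))"
  proof (intro mult_mono sum_mono mult_left_mono sum_nonneg mult_nonneg_nonneg)
    fix x
    show "(\<Sum>y\<in>J. \<bar>D x y\<bar>) \<le> 2 * phi_mix M X n * measure M (A x)"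
      using sum_abs_dependence[OF k Ag \<eta>(1) fin(2), of x] unfolding D_def B_def .
  next
    fix y
    have "(\<Sum>x\<in>I. \<bar>D x y\<bar>) \<le> (\<Sum>x\<in>I. measure M (A x \<inter> B y) + measure M (A x) * measure M (B y))"
      unfolding D_def by (intro sum_mono abs_triangle_ineq4[THEN order_trans]) simp
    also have "\<dots> = (\<Sum>x\<in>I. measure M (A x \<inter> B y)) + (\<Sum>x\<in>I. measure M (A x)) * measure M (B y)"
      by (simp add: sum.distrib sum_distrib_right)
    also have "(\<Sum>x\<in>I. measure M (A x \<inter> B y)) = measure M (\<Union>x\<in>I. A x \<inter> B y)"
      by (rule finite_measure_finite_Union[symmetric]) (use fin AM BM in \<open>auto simp: disjoint_family_on_def A_def\<close>)
    also have "(\<Union>x\<in>I. A x \<inter> B y) = B y" by (auto simp: I_def A_def B_def)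
    also have "(\<Sum>x\<in>I. measure M (A x)) = measure M (\<Union>x\<in>I. A x)"
      by (rule finite_measure_finite_Union[symmetric]) (use fin AM BM in \<open>auto simp: disjoint_family_on_def A_def\<close>)
    also have "\<dots> = 1"
    proof -
      have "(\<Union>x\<in>I. A x) = space M" by (auto simp: I_def A_def)
      then show ?thesis by (simp add: prob_space)
    qed
    finally show "(\<Sum>x\<in>I. \<bar>D x y\<bar>) \<le> 2 * measure M (B y)" by simp
  qed (auto simp: phi_mix_nonneg)
  also have "\<dots> = 4 * phi_mix M X n * expectation (\<lambda>w. (\<xi> w)\<^sup>2) * expectation (\<lambda>w. (\<eta> w)\<^sup>2)"
    unfolding e\<xi>[of "\<lambda>x. x\<^sup>2"] e\<eta>[of "\<lambda>x. x\<^sup>2"] by (simp add: sum_distrib_left sum_distrib_right mult_ac)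
  finally show ?thesis .
qed

end

section \<open>Discretisation: from variables of finite range to bounded variables\<close>

lemma floor_grid_abs_le:
  fixes x :: real
  shows "\<bar>\<lfloor>real (Suc N) * x\<rfloor> / real (Suc N) - x\<bar> \<le> 1 / real (Suc N)"
proof -
  have "\<bar>real_of_int \<lfloor>real (Suc N) * x\<rfloor> - real (Suc N) * x\<bar> \<le> 1" by linarith
  then have "\<bar>real_of_int \<lfloor>real (Suc N) * x\<rfloor> - real (Suc N) * x\<bar> / real (Suc N) \<le> 1 / real (Suc N)"
    by (rule divide_right_mono) simp
  also have "\<bar>real_of_int \<lfloor>real (Suc N) * x\<rfloor> - real (Suc N) * x\<bar> / real (Suc N)
     = \<bar>(real_of_int \<lfloor>real (Suc N) * x\<rfloor> - real (Suc N) * x) / real (Suc N)\<bar>"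
    by (simp add: abs_divide)
  finally show ?thesis by (simp add: diff_divide_distrib)
qed

lemma floor_grid_tendsto:
  fixes x :: real
  shows "(\<lambda>N. \<lfloor>real (Suc N) * x\<rfloor> / real (Suc N)) \<longlonglongrightarrow> x"
proof (rule LIM_zero_cancel, rule Lim_null_comparison)
  show "\<forall>\<^sub>F N in sequentially. norm (\<lfloor>real (Suc N) * x\<rfloor> / real (Suc N) - x) \<le> 1 / real (Suc N)"
    using floor_grid_abs_le[of _ x] by (auto simp: real_norm_def)
  show "(\<lambda>N. 1 / real (Suc N)) \<longlonglongrightarrow> 0"
    using LIMSEQ_inverse_real_of_nat by (simp add: inverse_eq_divide)
qed

lemma floor_grid_finite_range:
  fixes f :: "'b \<Rightarrow> real"
  assumes "\<And>w. w \<in> S \<Longrightarrow> \<bar>f w\<bar> \<le> K"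
  shows "finite ((\<lambda>w. \<lfloor>real (Suc N) * f w\<rfloor> / real (Suc N)) ` S)"
proof -
  have "\<lfloor>real (Suc N) * f w\<rfloor> \<in> {- \<lceil>real (Suc N) * K\<rceil> .. \<lceil>real (Suc N) * K\<rceil>}" if "w \<in> S" for w
  proof -
    have "\<bar>real (Suc N) * f w\<bar> \<le> real (Suc N) * K"
      unfolding abs_mult using assms[OF that] by (simp add: mult_left_mono)
    then show ?thesis by (simp; linarith)
  qed
  then have "(\<lambda>w. \<lfloor>real (Suc N) * f w\<rfloor> / real (Suc N)) ` S
     \<subseteq> (\<lambda>z. real_of_int z / real (Suc N)) ` {- \<lceil>real (Suc N) * K\<rceil> .. \<lceil>real (Suc N) * K\<rceil>}"
    by blast
  then show ?thesis by (rule finite_subset) simp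
qed

context rv_sequence
begin

text \<open>Rounding down to multiples of 1 / (N + 1) makes the ranges finite and, being a Borel
  map, keeps the variables measurable for past and future. The mesh is at most 1, so
  \<open>K + 1\<close> dominates all rounded variables and every expectation passes to the
  limit.\<close>

lemma covariance_bound_square:
  fixes \<xi> \<eta> :: "'a \<Rightarrow> real"
  assumes k: "k \<ge> 1" and \<xi>: "\<xi> \<in> borel_measurable (gen_alg M X {1..k})" "\<And>w. w \<in> space M \<Longrightarrow> \<bar>\<xi> w\<bar> \<le> K"
    and \<eta>: "\<eta> \<in> borel_measurable (gen_alg M X {k+n..})" "\<And>w. w \<in> space M \<Longrightarrow> \<bar>\<eta> w\<bar> \<le> K"
  shows "(expectation (\<lambda>w. \<xi> w * \<eta> w) - expectation \<xi> * expectation \<eta>)\<^sup>2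
      \<le> 4 * phi_mix M X n * expectation (\<lambda>w. (\<xi> w)\<^sup>2) * expectation (\<lambda>w. (\<eta> w)\<^sup>2)"
proof -
  define d :: "nat \<Rightarrow> real \<Rightarrow> real" where "d N x = \<lfloor>real (Suc N) * x\<rfloor> / real (Suc N)" for N x
  have [measurable]: "d N \<in> borel_measurable borel" for N unfolding d_def by measurable
  have d_bd: "\<bar>d N x\<bar> \<le> K + 1" if "\<bar>x\<bar> \<le> K" for N x
  proof -
    have "\<bar>d N x - x\<bar> \<le> 1 / real (Suc N)" unfolding d_def by (rule floor_grid_abs_le)
    also have "\<dots> \<le> 1" by simp
    finally show ?thesis using that by linarith
  qed
  have d_lim: "(\<lambda>N. d N x) \<longlonglongrightarrow> x" for x unfolding d_def by (rule floor_grid_tendsto)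
  have K2: "\<bar>a * b\<bar> \<le> (K+1) * (K+1)" if "\<bar>a\<bar> \<le> K+1" "\<bar>b\<bar> \<le> K+1" for a b :: real
    unfolding abs_mult using that by (intro mult_mono) auto
  have sq: "a\<^sup>2 \<le> (K+1) * (K+1)" if "\<bar>a\<bar> \<le> K+1" for a :: real
    using K2[OF that that] by (simp add: power2_eq_square)
  have [measurable]: "\<xi> \<in> borel_measurable M" "\<eta> \<in> borel_measurable M"
    using measurable_from_gen_alg[OF \<xi>(1)] measurable_from_gen_alg[OF \<eta>(1)] k by auto
  have l1: "(\<lambda>N. expectation (\<lambda>w. d N (\<xi> w) * d N (\<eta> w))) \<longlonglongrightarrow> expectation (\<lambda>w. \<xi> w * \<eta> w)"
    by (rule integral_dominated_convergence[where w="\<lambda>_. (K+1)*(K+1)"])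
       (auto intro!: tendsto_mult d_lim K2 d_bd \<xi> \<eta>)
  have l2: "(\<lambda>N. expectation (\<lambda>w. d N (\<xi> w))) \<longlonglongrightarrow> expectation \<xi>"
    by (rule integral_dominated_convergence[where w="\<lambda>_. K+1"]) (auto intro!: d_lim d_bd \<xi> \<eta>)
  have l3: "(\<lambda>N. expectation (\<lambda>w. d N (\<eta> w))) \<longlonglongrightarrow> expectation \<eta>"
    by (rule integral_dominated_convergence[where w="\<lambda>_. K+1"]) (auto intro!: d_lim d_bd \<xi> \<eta>)
  have l4: "(\<lambda>N. expectation (\<lambda>w. (d N (\<xi> w))\<^sup>2)) \<longlonglongrightarrow> expectation (\<lambda>w. (\<xi> w)\<^sup>2)"
    by (rule integral_dominated_convergence[where w="\<lambda>_. (K+1)*(K+1)"])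
       (auto intro!: tendsto_power d_lim sq d_bd \<xi> \<eta>)
  have l5: "(\<lambda>N. expectation (\<lambda>w. (d N (\<eta> w))\<^sup>2)) \<longlonglongrightarrow> expectation (\<lambda>w. (\<eta> w)\<^sup>2)"
    by (rule integral_dominated_convergence[where w="\<lambda>_. (K+1)*(K+1)"])
       (auto intro!: tendsto_power d_lim sq d_bd \<xi> \<eta>)
  show ?thesis
  proof (rule LIMSEQ_le)
    show "(\<lambda>N. (expectation (\<lambda>w. d N (\<xi> w) * d N (\<eta> w)) - expectation (\<lambda>w. d N (\<xi> w)) * expectation (\<lambda>w. d N (\<eta> w)))\<^sup>2)
      \<longlonglongrightarrow> (expectation (\<lambda>w. \<xi> w * \<eta> w) - expectation \<xi> * expectation \<eta>)\<^sup>2"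
      by (intro tendsto_intros l1 l2 l3)
    show "(\<lambda>N. 4 * phi_mix M X n * expectation (\<lambda>w. (d N (\<xi> w))\<^sup>2) * expectation (\<lambda>w. (d N (\<eta> w))\<^sup>2))
      \<longlonglongrightarrow> 4 * phi_mix M X n * expectation (\<lambda>w. (\<xi> w)\<^sup>2) * expectation (\<lambda>w. (\<eta> w)\<^sup>2)"
      by (intro tendsto_intros l4 l5)
    show "\<exists>N0. \<forall>N\<ge>N0. (expectation (\<lambda>w. d N (\<xi> w) * d N (\<eta> w)) - expectation (\<lambda>w. d N (\<xi> w)) * expectation (\<lambda>w. d N (\<eta> w)))\<^sup>2
      \<le> 4 * phi_mix M X n * expectation (\<lambda>w. (d N (\<xi> w))\<^sup>2) * expectation (\<lambda>w. (d N (\<eta> w))\<^sup>2)"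
    proof (intro exI[of _ 0] allI impI covariance_bound_finite_range)
      fix N
      show "1 \<le> k" by (rule k)
      show "(\<lambda>w. d N (\<xi> w)) \<in> borel_measurable (gen_alg M X {1..k})"
        using \<xi>(1) by measurable
      show "(\<lambda>w. d N (\<eta> w)) \<in> borel_measurable (gen_alg M X {k+n..})"
        using \<eta>(1) by measurable
      show "finite ((\<lambda>w. d N (\<xi> w)) ` space M)" "finite ((\<lambda>w. d N (\<eta> w)) ` space M)"
        unfolding d_def by (rule floor_grid_finite_range, rule \<xi> \<eta>, assumption)+
    qed
  qed
qed

lemma covariance_bound:
  fixes \<xi> \<eta> :: "'a \<Rightarrow> real"
  assumes "k \<ge> 1" "\<xi> \<in> borel_measurable (gen_alg M X {1..k})" "\<And>w. w \<in> space M \<Longrightarrow> \<bar>\<xi> w\<bar> \<le> K"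
    and "\<eta> \<in> borel_measurable (gen_alg M X {k+n..})" "\<And>w. w \<in> space M \<Longrightarrow> \<bar>\<eta> w\<bar> \<le> K"
  shows "\<bar>expectation (\<lambda>w. \<xi> w * \<eta> w) - expectation \<xi> * expectation \<eta>\<bar>
      \<le> 2 * sqrt (phi_mix M X n) * sqrt (expectation (\<lambda>w. (\<xi> w)\<^sup>2)) * sqrt (expectation (\<lambda>w. (\<eta> w)\<^sup>2))"
  using real_sqrt_le_mono[OF covariance_bound_square[OF assms]]
  by (simp add: real_sqrt_mult)

end

section \<open>Second moments of partial sums\<close>

text \<open>Each term of \<open>q\<close> occurs \<open>d\<close> times. This serves the gap
  exponents, which increase once in four doublings.\<close>

lemma summable_div:
  fixes q :: "nat \<Rightarrow> real"
  assumes q: "summable q" "\<And>n. q n \<ge> 0" and d: "d > 0"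
  shows "summable (\<lambda>j. q (j div d))"
proof (rule summableI_nonneg_bounded)
  fix N
  have "(\<Sum>j<N. q (j div d)) \<le> (\<Sum>j<N * d. q (j div d))"
    using d by (intro sum_mono2) (auto simp: q)
  also have "\<dots> = (\<Sum>l<N. \<Sum>j = l * d..<l * d + d. q (j div d))"
    by (rule sum.nat_group[symmetric])
  also have "\<dots> = (\<Sum>l<N. \<Sum>j = l * d..<l * d + d. q l)"
    by (intro sum.cong refl arg_cong[where f=q]) (auto intro!: div_nat_eqI simp: algebra_simps)
  also have "\<dots> = d * (\<Sum>l<N. q l)"
    by (simp add: sum_distrib_left)
  also have "\<dots> \<le> d * suminf q"
    using q by (intro mult_left_mono sum_le_suminf) auto
  finally show "(\<Sum>j<N. q (j div d)) \<le> d * suminf q" .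
qed (simp add: q)

text \<open>A discrete Gronwall inequality: 1 + \<rho> is at most exp \<rho>, and each new error is
  inflated by an exponential that is at least 1 so that it fits into the bracket.\<close>

lemma linear_recursion_bounded:
  fixes u \<rho> \<delta> :: "nat \<Rightarrow> real"
  assumes \<rho>: "summable \<rho>" "\<And>j. \<rho> j \<ge> 0" and \<delta>: "summable \<delta>" "\<And>j. \<delta> j \<ge> 0"
    and u0: "u 0 \<ge> 0" and u: "\<And>j. u (Suc j) \<le> (1 + \<rho> j) * u j + \<delta> j"
  shows "u j \<le> exp (suminf \<rho>) * (u 0 + suminf \<delta>)"
proof -
  have "u j \<le> exp (\<Sum>i<j. \<rho> i) * (u 0 + (\<Sum>i<j. \<delta> i))"
  proof (induction j)
    case (Suc j)
    have "u (Suc j) \<le> (1 + \<rho> j) * u j + \<delta> j" by (rule u)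
    also have "\<dots> \<le> (1 + \<rho> j) * (exp (\<Sum>i<j. \<rho> i) * (u 0 + (\<Sum>i<j. \<delta> i))) + \<delta> j"
      using Suc \<rho>(2)[of j] by (intro add_right_mono mult_left_mono) auto
    also have "\<dots> \<le> exp (\<rho> j) * (exp (\<Sum>i<j. \<rho> i) * (u 0 + (\<Sum>i<j. \<delta> i))) + \<delta> j"
      using u0 \<delta>(2) by (intro add_right_mono mult_right_mono) (auto intro!: mult_nonneg_nonneg add_nonneg_nonneg sum_nonneg exp_ge_add_one_self)
    also have "\<delta> j \<le> exp (\<Sum>i<Suc j. \<rho> i) * \<delta> j"
      using \<delta>(2)[of j] mult_right_mono[of 1 "exp (\<Sum>i<Suc j. \<rho> i)" "\<delta> j"] \<rho>(2)
      by (simp add: sum_nonneg add_nonneg_nonneg)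
    finally show ?case by (simp add: exp_add algebra_simps)
  qed simp
  also have "\<dots> \<le> exp (suminf \<rho>) * (u 0 + suminf \<delta>)"
    using u0 \<rho> \<delta> by (intro mult_mono add_left_mono sum_le_suminf) (auto intro!: sum_le_suminf add_nonneg_nonneg sum_nonneg)
  finally show ?thesis .
qed

text \<open>Minkowski's inequality for two functions, in the form that avoids norms: optimise
  (f + g)^2 <= (1 + t) f^2 + (1 + 1/t) g^2 over t.\<close>
lemma (in prob_space) second_moment_add_le:
  fixes f g :: "'a \<Rightarrow> real"
  assumes [measurable]: "f \<in> borel_measurable M" "g \<in> borel_measurable M"
    and int: "integrable M (\<lambda>w. (f w)\<^sup>2)" "integrable M (\<lambda>w. (g w)\<^sup>2)"
    and a: "expectation (\<lambda>w. (f w)\<^sup>2) \<le> a\<^sup>2" "a > 0"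
    and b: "expectation (\<lambda>w. (g w)\<^sup>2) \<le> b\<^sup>2" "b > 0"
  shows "expectation (\<lambda>w. (f w + g w)\<^sup>2) \<le> (a + b)\<^sup>2"
proof -
  have pw: "(f w + g w)\<^sup>2 \<le> (1 + b / a) * (f w)\<^sup>2 + (1 + a / b) * (g w)\<^sup>2" for w
  proof -
    have "0 \<le> (b * f w - a * g w)\<^sup>2 / (a * b)"
      using a b by (intro divide_nonneg_pos) auto
    also have "\<dots> = (b / a) * (f w)\<^sup>2 + (a / b) * (g w)\<^sup>2 - 2 * f w * g w"
      using a b by (simp add: power2_eq_square field_simps)
    finally show ?thesis by (simp add: power2_eq_square algebra_simps)
  qed
  have "expectation (\<lambda>w. (f w + g w)\<^sup>2) \<le> expectation (\<lambda>w. (1 + b / a) * (f w)\<^sup>2 + (1 + a / b) * (g w)\<^sup>2)"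
    by (rule integral_mono') (use int pw a b in \<open>auto intro!: add_nonneg_nonneg mult_nonneg_nonneg\<close>)
  also have "\<dots> = (1 + b / a) * expectation (\<lambda>w. (f w)\<^sup>2) + (1 + a / b) * expectation (\<lambda>w. (g w)\<^sup>2)"
    using int by simp
  also have "\<dots> \<le> (1 + b / a) * a\<^sup>2 + (1 + a / b) * b\<^sup>2"
    using a b by (intro add_mono mult_left_mono) (auto intro!: add_nonneg_nonneg)
  also have "\<dots> = (a + b)\<^sup>2"
    using a b by (simp add: power2_eq_square field_simps)
  finally show ?thesis .
qed

text \<open>\<open>Suc n\<close> makes the exponents of two start at 1, as in the assumed
  series.\<close>

locale phi_mixing = rv_sequence +
  assumes ident: "i \<ge> 1 \<Longrightarrow> distr M borel (X i) = distr M borel (X 1)"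
    and summ: "summable (\<lambda>n. sqrt (phi_mix M X (2 ^ Suc n)))"

text \<open>\<open>K\<close> secures integrability and the boundedness required by the covariance
  inequality, whereas the moment estimates depend on \<open>\<sigma>\<close> alone; this is
  essential because the truncation level will grow with the number of terms. Positivity of
  \<open>\<sigma>\<close> keeps the bounds positive, as the optimised Minkowski step divides by
  them.\<close>

locale centered_functionals = rv_sequence +
  fixes Z :: "nat \<Rightarrow> 'a \<Rightarrow> real" and K \<sigma> :: real
  assumes Z_meas: "i \<ge> 1 \<Longrightarrow> Z i \<in> borel_measurable (gen_alg M X {i})"
    and Z_bd: "i \<ge> 1 \<Longrightarrow> w \<in> space M \<Longrightarrow> \<bar>Z i w\<bar> \<le> K"
    and Z_mean: "i \<ge> 1 \<Longrightarrow> expectation (Z i) = 0"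
    and Z_var: "i \<ge> 1 \<Longrightarrow> expectation (\<lambda>w. (Z i w)\<^sup>2) \<le> \<sigma>\<^sup>2"
    and \<sigma>_pos: "\<sigma> > 0"
begin

text \<open>Indexed by the starting point as well as the length, because blocks of equal length need
  not have the same distribution.\<close>

definition S :: "nat \<Rightarrow> nat \<Rightarrow> 'a \<Rightarrow> real" where
  "S a n w = (\<Sum>i\<in>{a<..a+n}. Z i w)"

lemma S_measurable_gen: "{a<..a+n} \<subseteq> I \<Longrightarrow> S a n \<in> borel_measurable (gen_alg M X I)"
  unfolding S_def by (intro borel_measurable_sum measurable_gen_alg_mono[OF Z_meas]) auto

lemma S_measurable [measurable]: "S a n \<in> borel_measurable M"
  by (rule measurable_from_gen_alg[OF S_measurable_gen[OF order_refl]]) auto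

lemma Z_measurable: "i \<ge> 1 \<Longrightarrow> Z i \<in> borel_measurable M"
  by (rule measurable_from_gen_alg[OF Z_meas]) auto

lemma S_bd: "w \<in> space M \<Longrightarrow> \<bar>S a n w\<bar> \<le> n * K"
proof -
  assume w: "w \<in> space M"
  have "\<bar>S a n w\<bar> \<le> (\<Sum>i\<in>{a<..a+n}. \<bar>Z i w\<bar>)" unfolding S_def by (rule sum_abs)
  also have "\<dots> \<le> (\<Sum>i\<in>{a<..a+n}. K)" by (intro sum_mono Z_bd w) auto
  finally show ?thesis by simp
qed

lemma Z_integrable: "i \<ge> 1 \<Longrightarrow> integrable M (Z i)"
  by (rule integrable_const_bound[where B=K]) (auto intro!: Z_bd Z_measurable)

lemma Z_sq_integrable: "i \<ge> 1 \<Longrightarrow> integrable M (\<lambda>w. (Z i w)\<^sup>2)"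
  by (rule integrable_const_bound[where B="K\<^sup>2"])
     (auto intro!: borel_measurable_power Z_measurable abs_le_square_iff[THEN iffD1] order_trans[OF Z_bd])

lemma S_sq_integrable: "integrable M (\<lambda>w. (S a n w)\<^sup>2)"
  by (rule integrable_const_bound[where B="(n*K)\<^sup>2"])
     (auto intro!: abs_le_square_iff[THEN iffD1] order_trans[OF S_bd])

lemma S_mean: "expectation (S a n) = 0"
  unfolding S_def by (subst Bochner_Integration.integral_sum) (auto intro!: Z_integrable sum.neutral Z_mean)

lemma S_split: "S a (m + n) w = S a m w + S (a + m) n w"
proof -
  have "{a<..a+(m+n)} = {a<..a+m} \<union> {a+m<..a+m+n}" by auto
  then show ?thesis unfolding S_def by (simp add: sum.union_disjoint)
qed

text \<open>Cauchy-Schwarz alone, without mixing: the 2-norm grows linearly in the length. This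
  starts the doubling recursion and pays for the gaps.\<close>

lemma S_crude: "expectation (\<lambda>w. (S a n w)\<^sup>2) \<le> (n * \<sigma>)\<^sup>2"
proof -
  have "expectation (\<lambda>w. (S a n w)\<^sup>2) \<le> expectation (\<lambda>w. n * (\<Sum>i\<in>{a<..a+n}. (Z i w)\<^sup>2))"
    unfolding S_def using sum_square_le_card[of "{a<..a+n}"]
    by (intro integral_mono' Bochner_Integration.integrable_mult_right Bochner_Integration.integrable_sum Z_sq_integrable)
       (auto intro!: mult_nonneg_nonneg sum_nonneg)
  also have "\<dots> = n * (\<Sum>i\<in>{a<..a+n}. expectation (\<lambda>w. (Z i w)\<^sup>2))"
    by (simp add: Bochner_Integration.integral_sum Z_sq_integrable)
  also have "\<dots> \<le> n * (\<Sum>i\<in>{a<..a+n}. \<sigma>\<^sup>2)"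
    by (intro mult_left_mono sum_mono Z_var) auto
  finally show ?thesis by (simp add: power2_eq_square mult_ac)
qed

text \<open>Shift the second block by a gap of length m, so that the mixing coefficient at m
  applies; the gap itself is estimated crudely.\<close>
lemma S_double:
  assumes \<beta>: "\<And>a. expectation (\<lambda>w. (S a n w)\<^sup>2) \<le> \<beta>\<^sup>2" "\<beta> > 0" and n: "n \<ge> 1" and m: "m \<ge> 1"
  shows "expectation (\<lambda>w. (S a (2 * n) w)\<^sup>2)
     \<le> (sqrt 2 * (1 + sqrt (phi_mix M X m)) * \<beta> + 2 * m * \<sigma>)\<^sup>2"
proof -
  define \<rho> where "\<rho> = sqrt (phi_mix M X m)"
  have \<rho>: "\<rho> \<ge> 0" by (simp add: \<rho>_def phi_mix_nonneg)
  have K: "K \<ge> 0"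
  proof -
    obtain w where "w \<in> space M" using not_empty by auto
    then show ?thesis using Z_bd[of 1 w] by simp
  qed
  \<comment> \<open>The second block is moved right by m: the skipped gap is added back, and the
    overshoot past a + 2 n is subtracted.\<close>
  have eq: "S a (2 * n) w = (S a n w + S (a + n + m) n w) + (S (a + n) m w - S (a + 2 * n) m w)" for w
    using S_split[of a n n w] S_split[of "a+n" m n w] S_split[of "a+n" n m w]
    by (simp add: mult_2 add.commute add.left_commute)
  have prod_int: "integrable M (\<lambda>w. S a n w * S (a + n + m) n w)"
  proof (rule integrable_const_bound[where B="(n*K)*(n*K)"], rule AE_I2)
    fix w assume w: "w \<in> space M"
    show "norm (S a n w * S (a + n + m) n w) \<le> (n*K)*(n*K)"
      unfolding real_norm_def abs_mult using K by (intro mult_mono S_bd w) auto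
  qed measurable
  have "\<bar>expectation (\<lambda>w. S a n w * S (a + n + m) n w) - expectation (S a n) * expectation (S (a + n + m) n)\<bar>
      \<le> 2 * sqrt (phi_mix M X m) * sqrt (expectation (\<lambda>w. (S a n w)\<^sup>2)) * sqrt (expectation (\<lambda>w. (S (a + n + m) n w)\<^sup>2))"
    by (rule covariance_bound[where k="a+n" and K="n*K"])
       (use n in \<open>auto intro!: S_measurable_gen S_bd\<close>)
  also have "\<dots> \<le> 2 * \<rho> * \<beta> * \<beta>"
    using \<beta> \<rho> unfolding \<rho>_def[symmetric]
    by (intro mult_mono real_le_lsqrt) (auto intro!: mult_nonneg_nonneg)
  finally have cov: "expectation (\<lambda>w. S a n w * S (a + n + m) n w) \<le> 2 * \<rho> * \<beta>\<^sup>2"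
    by (simp add: S_mean power2_eq_square)
  have "expectation (\<lambda>w. (S a n w + S (a + n + m) n w)\<^sup>2)
      = expectation (\<lambda>w. (S a n w)\<^sup>2 + (S (a + n + m) n w)\<^sup>2 + 2 * (S a n w * S (a + n + m) n w))"
    by (simp add: power2_sum algebra_simps)
  also have "\<dots> = expectation (\<lambda>w. (S a n w)\<^sup>2) + expectation (\<lambda>w. (S (a + n + m) n w)\<^sup>2)
      + 2 * expectation (\<lambda>w. S a n w * S (a + n + m) n w)"
    using prod_int by (simp add: S_sq_integrable)
  also have "\<dots> \<le> \<beta>\<^sup>2 + \<beta>\<^sup>2 + 2 * (2 * \<rho> * \<beta>\<^sup>2)"
    using cov \<beta>(1) by (intro add_mono mult_left_mono) auto
  \<comment> \<open>The added term completes the square to (1 + \<rho>)^2.\<close>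
  also have "\<dots> \<le> \<beta>\<^sup>2 + \<beta>\<^sup>2 + 2 * (2 * \<rho> * \<beta>\<^sup>2) + 2 * (\<rho> * \<beta>)\<^sup>2"
    by simp
  also have "\<dots> = 2 * (1 + \<rho>)\<^sup>2 * \<beta>\<^sup>2"
    by (simp add: power2_eq_square algebra_simps)
  also have "\<dots> = (sqrt 2 * (1 + \<rho>) * \<beta>)\<^sup>2"
    by (simp add: power_mult_distrib)
  finally have main: "expectation (\<lambda>w. (S a n w + S (a + n + m) n w)\<^sup>2) \<le> (sqrt 2 * (1 + \<rho>) * \<beta>)\<^sup>2" .
  have sq: "(x - y)\<^sup>2 \<le> 2 * x\<^sup>2 + 2 * y\<^sup>2" for x y :: real
  proof -
    have "0 \<le> (x + y)\<^sup>2" by simp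
    then show ?thesis by (simp add: power2_eq_square algebra_simps)
  qed
  have gap_int: "integrable M (\<lambda>w. 2 * (S (a + n) m w)\<^sup>2 + 2 * (S (a + 2 * n) m w)\<^sup>2)"
    by (simp add: S_sq_integrable)
  have "expectation (\<lambda>w. (S (a + n) m w - S (a + 2 * n) m w)\<^sup>2)
      \<le> expectation (\<lambda>w. 2 * (S (a + n) m w)\<^sup>2 + 2 * (S (a + 2 * n) m w)\<^sup>2)"
    by (rule integral_mono'[OF gap_int]) (auto intro: sq)
  also have "\<dots> = 2 * expectation (\<lambda>w. (S (a + n) m w)\<^sup>2) + 2 * expectation (\<lambda>w. (S (a + 2 * n) m w)\<^sup>2)"
    by (simp add: S_sq_integrable)
  also have "\<dots> \<le> 2 * (m * \<sigma>)\<^sup>2 + 2 * (m * \<sigma>)\<^sup>2"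
    by (intro add_mono mult_left_mono S_crude) auto
  also have "\<dots> = (2 * m * \<sigma>)\<^sup>2" by (simp add: power_mult_distrib)
  finally have gap: "expectation (\<lambda>w. (S (a + n) m w - S (a + 2 * n) m w)\<^sup>2) \<le> (2 * m * \<sigma>)\<^sup>2" .
  show ?thesis
    unfolding eq \<rho>_def[symmetric]
  proof (rule second_moment_add_le)
    show "expectation (\<lambda>w. (S a n w + S (a + n + m) n w)\<^sup>2) \<le> (sqrt 2 * (1 + \<rho>) * \<beta>)\<^sup>2"
      by (rule main)
    show "expectation (\<lambda>w. (S (a + n) m w - S (a + 2 * n) m w)\<^sup>2) \<le> (2 * real m * \<sigma>)\<^sup>2"
      using gap by simp
    show "integrable M (\<lambda>w. (S a n w + S (a + n + m) n w)\<^sup>2)"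
      unfolding power2_sum using prod_int
      by (auto intro!: Bochner_Integration.integrable_add S_sq_integrable simp: mult.assoc)
    show "integrable M (\<lambda>w. (S (a + n) m w - S (a + 2 * n) m w)\<^sup>2)"
      by (rule Bochner_Integration.integrable_bound[OF gap_int]) (auto intro!: order_trans[OF sq])
    show "0 < sqrt 2 * (1 + \<rho>) * \<beta>" using \<rho> \<beta> by (auto intro!: mult_pos_pos)
    show "0 < 2 * real m * \<sigma>" using m \<sigma>_pos by auto
  qed measurable
qed

text \<open>A bound for the 2-norm of a block of length 2^j in units of \<sigma> * sqrt 2 ^ j. The
  recursion is the doubling estimate with gap m = 2 ^ Suc (j div 4), divided by the next unit: the
  gap term 2 * m * \<sigma> becomes sqrt 2 * m / sqrt 2 ^ j.\<close>

primrec dyadic_const :: "nat \<Rightarrow> real" where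
  "dyadic_const 0 = 1"
| "dyadic_const (Suc j) = (1 + sqrt (phi_mix M X (2 ^ Suc (j div 4)))) * dyadic_const j
     + sqrt 2 * 2 ^ Suc (j div 4) / sqrt 2 ^ j"

lemma dyadic_const_pos: "dyadic_const j > 0"
  by (induction j) (auto intro!: add_pos_pos mult_pos_pos add_pos_nonneg phi_mix_nonneg)

lemma S_dyadic: "expectation (\<lambda>w. (S a (2 ^ j) w)\<^sup>2) \<le> (dyadic_const j * \<sigma> * sqrt 2 ^ j)\<^sup>2"
proof (induction j arbitrary: a)
  case 0
  show ?case using S_crude[of a 1] by simp
next
  case (Suc j)
  have "expectation (\<lambda>w. (S a (2 * 2 ^ j) w)\<^sup>2)
     \<le> (sqrt 2 * (1 + sqrt (phi_mix M X (2 ^ Suc (j div 4)))) * (dyadic_const j * \<sigma> * sqrt 2 ^ j)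
         + 2 * real (2 ^ Suc (j div 4)) * \<sigma>)\<^sup>2"
    by (rule S_double[OF Suc]) (auto simp: dyadic_const_pos \<sigma>_pos)
  also have "sqrt 2 * (1 + sqrt (phi_mix M X (2 ^ Suc (j div 4)))) * (dyadic_const j * \<sigma> * sqrt 2 ^ j)
         + 2 * real (2 ^ Suc (j div 4)) * \<sigma> = dyadic_const (Suc j) * \<sigma> * sqrt 2 ^ Suc j"
    by (simp add: field_simps)
  finally show ?case by simp
qed

text \<open>Cauchy-Schwarz over the r blocks. The loss of r^2 instead of r is harmless, because r
  stays fixed while the block length grows.\<close>

lemma S_blocks:
  assumes "\<And>a. expectation (\<lambda>w. (S a n w)\<^sup>2) \<le> B"
  shows "expectation (\<lambda>w. (S a (r * n) w)\<^sup>2) \<le> (real r)\<^sup>2 * B"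
proof -
  have eq: "S a (r * n) w = (\<Sum>s<r. S (a + s * n) n w)" for w
  proof (induction r)
    case (Suc r)
    show ?case using S_split[of a "r * n" n w] Suc by (simp add: add.commute)
  qed (simp add: S_def)
  have "expectation (\<lambda>w. (S a (r * n) w)\<^sup>2) \<le> expectation (\<lambda>w. r * (\<Sum>s<r. (S (a + s * n) n w)\<^sup>2))"
    unfolding eq using sum_square_le_card[of "{..<r}"]
    by (intro integral_mono' Bochner_Integration.integrable_mult_right Bochner_Integration.integrable_sum S_sq_integrable)
       (auto intro!: mult_nonneg_nonneg sum_nonneg)
  also have "\<dots> = r * (\<Sum>s<r. expectation (\<lambda>w. (S (a + s * n) n w)\<^sup>2))"
    by (simp add: Bochner_Integration.integral_sum S_sq_integrable)
  also have "\<dots> \<le> r * (\<Sum>s<r. B)"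
    by (intro mult_left_mono sum_mono assms) auto
  finally show ?thesis by (simp add: power2_eq_square mult_ac)
qed

lemma dyadic_const_bounded:
  assumes summ: "summable (\<lambda>n. sqrt (phi_mix M X (2 ^ Suc n)))"
  defines "C \<equiv> exp (\<Sum>j. sqrt (phi_mix M X (2 ^ Suc (j div 4)))) * (1 + (\<Sum>j. sqrt 2 * 2 ^ Suc (j div 4) / sqrt 2 ^ j))"
  shows "dyadic_const j \<le> C"
proof -
  have *: "summable (\<lambda>j. 2 * sqrt 2 * (1/2) ^ (j div 4))"
    by (intro summable_mult summable_div[where q="\<lambda>l. (1/2) ^ l"] summable_geometric) auto
  have s2: "summable (\<lambda>j. sqrt 2 * 2 ^ Suc (j div 4) / sqrt 2 ^ j)"
  proof (rule summable_comparison_test'[OF *, where N=0])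
    fix j :: nat
    \<comment> \<open>With l = j div 4 one has 2^(2 l) = sqrt 2 ^ (4 l), which is at most sqrt 2 ^
      j. So the ratio of the gap to the scale of the block is at most 2^(-l), a geometric series
      with each term repeated four times.\<close>
    have "(2::real) ^ (j div 4) * 2 ^ (j div 4) = sqrt 2 ^ (4 * (j div 4))"
    proof -
      have "sqrt 2 ^ 4 = (4::real)" using power_mult[of "sqrt 2" 2 2] by simp
      then show ?thesis by (simp add: power_mult flip: power_mult_distrib)
    qed
    also have "\<dots> \<le> sqrt 2 ^ j" by (rule power_increasing) auto
    finally have "(2::real) ^ (j div 4) / sqrt 2 ^ j \<le> (1/2) ^ (j div 4)"
      by (simp add: field_simps power_divide)
    then have "2 * sqrt 2 * (2 ^ (j div 4) / sqrt 2 ^ j) \<le> 2 * sqrt 2 * (1/2) ^ (j div 4)"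
      by (rule mult_left_mono) auto
    then show "norm (sqrt 2 * 2 ^ Suc (j div 4) / sqrt 2 ^ j) \<le> 2 * sqrt 2 * (1/2) ^ (j div 4)"
      by (simp add: mult_ac)
  qed
  have s1: "summable (\<lambda>j. sqrt (phi_mix M X (2 ^ Suc (j div 4))))"
    by (rule summable_div[OF summ]) (auto simp: phi_mix_nonneg)
  show ?thesis
    unfolding C_def using linear_recursion_bounded[OF s1 _ s2, of dyadic_const j] by (simp add: phi_mix_nonneg)
qed

end

text \<open>\<open>C\<close> is obtained before \<open>Z\<close>, \<open>K\<close>,
  \<open>\<sigma>\<close>, \<open>r\<close> and \<open>i\<close>: a single constant depending on the
  mixing coefficients serves all truncation levels.\<close>

lemma (in phi_mixing) second_moment_bound:
  obtains C where "C \<ge> 0" "\<And>Z K \<sigma> r i. centered_functionals M X Z K \<sigma> \<Longrightarrow>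
    expectation (\<lambda>w. (\<Sum>j=1..r * 2 ^ i. Z j w)\<^sup>2) \<le> C * (real r)\<^sup>2 * 2 ^ i * \<sigma>\<^sup>2"
proof
  let ?C = "exp (\<Sum>j. sqrt (phi_mix M X (2 ^ Suc (j div 4)))) * (1 + (\<Sum>j. sqrt 2 * 2 ^ Suc (j div 4) / sqrt 2 ^ j))"
  show "?C\<^sup>2 \<ge> 0" by simp
  fix Z K \<sigma> r i assume "centered_functionals M X Z K \<sigma>"
  then interpret centered_functionals M X Z K \<sigma> .
  have "expectation (\<lambda>w. (S a (2 ^ i) w)\<^sup>2) \<le> (?C * \<sigma> * sqrt 2 ^ i)\<^sup>2" for a
    using S_dyadic[of a i] dyadic_const_pos[of i] dyadic_const_bounded[OF summ, of i] \<sigma>_pos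
    by (elim order_trans, intro power_mono mult_right_mono) auto
  from S_blocks[OF this, of 0 r]
  have "expectation (\<lambda>w. (S 0 (r * 2 ^ i) w)\<^sup>2) \<le> (real r)\<^sup>2 * (?C * \<sigma> * sqrt 2 ^ i)\<^sup>2" .
  also have "\<dots> = ?C\<^sup>2 * (real r)\<^sup>2 * 2 ^ i * \<sigma>\<^sup>2"
  proof -
    have "(sqrt 2 ^ i)\<^sup>2 = (2::real) ^ i"
      by (simp add: power_mult[symmetric] mult.commute[of i]) (simp add: power_mult)
    then show ?thesis unfolding power_mult_distrib by (simp only: mult_ac)
  qed
  finally show "expectation (\<lambda>w. (\<Sum>j=1..r * 2 ^ i. Z j w)\<^sup>2) \<le> ?C\<^sup>2 * (real r)\<^sup>2 * 2 ^ i * \<sigma>\<^sup>2"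
    unfolding S_def by (simp add: atLeastSucAtMost_greaterThanAtMost[of 0, symmetric])
qed

section \<open>The strong law of large numbers\<close>

text \<open>With y the value of the integrable function at the first variable, taking expectations
  bounds the weighted series of truncated second moments by the first moment.\<close>

lemma sum_truncated_squares_le:
  fixes y :: real
  assumes "y \<ge> 0"
  shows "(\<Sum>j<N. (min y (2 ^ j))\<^sup>2 / 2 ^ j) \<le> 4 * y"
proof -
  \<comment> \<open>The claim is strengthened for the induction: while 2^N <= y the sum is geometric
    with ratio 2; afterwards the whole remaining tail, 2 y^2 / 2^N, is kept in reserve.\<close>
  have "(\<Sum>j<N. (min y (2 ^ j))\<^sup>2 / 2 ^ j) \<le> (if 2 ^ N \<le> y then 2 ^ N else 4 * y - 2 * y\<^sup>2 / 2 ^ N)"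
  proof (induction N)
    case 0
    have "y * y \<le> 1 * y" if "y < 1" using that assms by (intro mult_right_mono) auto
    then show ?case using assms by (auto simp: power2_eq_square)
  next
    case (Suc N)
    let ?t = "2 ^ N :: real"
    show ?case
    proof (cases "?t \<le> y")
      case True
      then have 1: "(\<Sum>j<Suc N. (min y (2 ^ j))\<^sup>2 / 2 ^ j) \<le> 2 * ?t"
        using Suc by (simp add: min_absorb2 power2_eq_square)
      show ?thesis
      proof (cases "2 ^ Suc N \<le> y")
        case False
        \<comment> \<open>At the crossing t <= y < 2 t, with t = 2^N, the invariant changes form.
          The required inequality is 4 t y - y^2 - 2 t^2 >= 0, whose left side is this sum of
          nonnegative products.\<close>
        then have "0 \<le> (y - ?t) * (2 * ?t - y) + ?t * (y - ?t) + ?t * ?t"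
          using True by (intro add_nonneg_nonneg mult_nonneg_nonneg) auto
        then have "2 * ?t \<le> 4 * y - 2 * y\<^sup>2 / 2 ^ Suc N"
          by (simp add: field_simps power2_eq_square)
        with 1 False show ?thesis by simp
      qed (use 1 in simp)
    next
      case False
      then have "(\<Sum>j<Suc N. (min y (2 ^ j))\<^sup>2 / 2 ^ j) \<le> 4 * y - 2 * y\<^sup>2 / ?t + y\<^sup>2 / ?t"
        using Suc by (simp add: min_absorb1)
      also have "\<dots> = 4 * y - 2 * y\<^sup>2 / 2 ^ Suc N"
        by (simp add: field_simps)
      finally have 2: "(\<Sum>j<Suc N. (min y (2 ^ j))\<^sup>2 / 2 ^ j) \<le> 4 * y - 2 * y\<^sup>2 / 2 ^ Suc N" .
      have "?t > 0" by simp
      then have "\<not> 2 ^ Suc N \<le> y" using False unfolding power_Suc by linarith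
      with 2 show ?thesis by simp
    qed
  qed
  also have "\<dots> \<le> 4 * y" using assms by auto
  finally show ?thesis .
qed

text \<open>A large n lies between r * 2^i and (r + 1) * 2^i with N <= r < 2 N. Monotone partial
  sums are compared at these two ends, whose ratio is at most 1 + 1/N, and only finitely many r
  occur, so the convergence is uniform over them.\<close>

lemma average_tendsto_from_dyadic_multiples:
  fixes Y :: "nat \<Rightarrow> real"
  assumes Y: "\<And>j. Y j \<ge> 0"
    and lim: "\<And>r. r \<ge> 1 \<Longrightarrow> (\<lambda>i. (\<Sum>j=1..r * 2 ^ i. Y j) / (r * 2 ^ i)) \<longlonglongrightarrow> \<mu>"
  shows "(\<lambda>n. (\<Sum>j=1..n. Y j) / n) \<longlonglongrightarrow> \<mu>"
proof (rule LIMSEQ_I)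
  fix \<epsilon> :: real assume \<epsilon>: "\<epsilon> > 0"
  define A where "A n = (\<Sum>j=1..n. Y j)" for n
  have A_mono: "A m \<le> A n" if "m \<le> n" for m n
    unfolding A_def using that Y by (intro sum_mono2) auto
  have A_nn: "A n \<ge> 0" for n unfolding A_def by (simp add: sum_nonneg Y)
  have \<mu>: "\<mu> \<ge> 0"
    by (rule LIMSEQ_le_const[OF lim[of 1]]) (auto intro!: exI[of _ 0] divide_nonneg_nonneg sum_nonneg Y)
  define \<delta> where "\<delta> = \<epsilon> / 3"
  have \<delta>: "\<delta> > 0" using \<epsilon> by (simp add: \<delta>_def)
  obtain s :: nat where s: "(\<mu> + \<delta>) / \<delta> < 2 ^ s"
    using real_arch_pow[of 2 "(\<mu> + \<delta>) / \<delta>"] by auto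
  \<comment> \<open>A power of two, so that the windows from N * 2^i to 2 N * 2^i tile the large
    integers; its size makes \<mu> + \<delta> at most \<delta> * N, which absorbs the one extra
    block.\<close>
  define N :: nat where "N = 2 ^ s"
  have N: "\<mu> + \<delta> \<le> \<delta> * N" "N \<ge> 1" using s \<delta> by (auto simp: N_def field_simps)
  \<comment> \<open>The value 2 N is included because the upper neighbour r + 1 can reach
    it.\<close>
  have "\<forall>\<^sub>F i in sequentially. \<forall>r\<in>{1..2*N}. \<bar>A (r * 2 ^ i) / (r * 2 ^ i) - \<mu>\<bar> < \<delta>"
    using tendstoD[OF lim \<delta>] by (auto simp: eventually_ball_finite_distrib dist_real_def A_def)
  then obtain i0 where i0: "\<And>i r. i \<ge> i0 \<Longrightarrow> 1 \<le> r \<Longrightarrow> r \<le> 2 * N \<Longrightarrow> \<bar>A (r * 2 ^ i) / (r * 2 ^ i) - \<mu>\<bar> < \<delta>"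
    unfolding eventually_sequentially by fastforce
  show "\<exists>n0. \<forall>n\<ge>n0. norm ((\<Sum>j=1..n. Y j) / n - \<mu>) < \<epsilon>"
  proof (intro exI allI impI)
    fix n :: nat assume n: "n \<ge> 2 ^ (s + i0)"
    then have "n \<ge> 1" by (metis one_le_numeral one_le_power order_trans)
    then obtain l where l: "2 ^ l \<le> n" "n < 2 ^ (l + 1)"
      using ex_power_ivl1[of 2 n] by auto
    have "(2::nat) ^ (s + i0) < 2 ^ (l + 1)" using n l by linarith
    then have "s + i0 < l + 1" by (rule power_less_imp_less_exp[rotated]) simp
    then have "s + i0 \<le> l" by simp
    then obtain i where i: "l = s + i" "i \<ge> i0" by (metis add.assoc le_iff_add le_add1)
    define r where "r = n div 2 ^ i"
    have r: "r * 2 ^ i \<le> n" "n < (r + 1) * 2 ^ i"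
      unfolding r_def using dividend_less_div_times[of "2 ^ i" n] by (auto simp: algebra_simps)
    have rN: "N \<le> r" "r < 2 * N"
    proof -
      have "N * 2 ^ i \<le> n" "n < 2 * N * 2 ^ i" using l by (auto simp: N_def i power_add)
      then show "N \<le> r" "r < 2 * N"
        unfolding r_def by (auto simp: less_eq_div_iff_mult_less_eq div_less_iff_less_mult)
    qed
    have r1: "r \<ge> 1" using rN N by linarith
    have n0: "real n > 0" using \<open>n \<ge> 1\<close> by simp
    have nr: "real r * 2 ^ i \<le> real n" "real n \<le> (real r + 1) * 2 ^ i"
    proof -
      have "real (r * 2 ^ i) \<le> real n" "real n \<le> real ((r + 1) * 2 ^ i)"
        using r by (simp_all only: of_nat_le_iff less_imp_le)
      then show "real r * 2 ^ i \<le> real n" "real n \<le> (real r + 1) * 2 ^ i" by (simp_all add: algebra_simps)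
    qed
    have \<delta>r: "\<mu> + \<delta> \<le> \<delta> * r"
      using N(1) rN(1) \<delta> by (meson mult_left_mono of_nat_le_iff order_trans less_imp_le)
    have up: "A n / n \<le> \<mu> + 2 * \<delta>"
    proof -
      have "\<bar>A ((r + 1) * 2 ^ i) / real ((r + 1) * 2 ^ i) - \<mu>\<bar> < \<delta>"
        by (rule i0) (use i rN in auto)
      then have "A ((r + 1) * 2 ^ i) / real ((r + 1) * 2 ^ i) \<le> \<mu> + \<delta>"
        by linarith
      moreover have "real ((r + 1) * 2 ^ i) = (real r + 1) * 2 ^ i" by (simp add: algebra_simps)
      ultimately have "A ((r + 1) * 2 ^ i) / ((real r + 1) * 2 ^ i) \<le> \<mu> + \<delta>"
        by (simp only:)
      then have "A ((r + 1) * 2 ^ i) \<le> (\<mu> + \<delta>) * ((real r + 1) * 2 ^ i)"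
        by (subst (asm) pos_divide_le_eq) auto
      then have "A n \<le> (\<mu> + \<delta>) * ((real r + 1) * 2 ^ i)"
        using A_mono[of n "(r+1) * 2 ^ i"] r by linarith
      also have "\<dots> = ((\<mu> + \<delta>) * real r + (\<mu> + \<delta>)) * 2 ^ i" by (simp add: algebra_simps)
      also have "\<dots> \<le> ((\<mu> + \<delta>) * real r + \<delta> * real r) * 2 ^ i"
        using \<delta>r by (intro mult_right_mono add_left_mono) auto
      also have "\<dots> = (\<mu> + 2 * \<delta>) * (real r * 2 ^ i)" by (simp add: algebra_simps)
      also have "\<dots> \<le> (\<mu> + 2 * \<delta>) * n" using nr \<mu> \<delta> by (intro mult_left_mono) auto
      finally show ?thesis using n0 by (simp add: pos_divide_le_eq)
    qed
    have low: "A n / n \<ge> \<mu> - 2 * \<delta>"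
    \<comment> \<open>The comparison multiplies n by \<mu> - 2 \<delta>, which must be nonnegative;
      otherwise nonnegativity of the average suffices.\<close>
    proof (cases "\<mu> - 2 * \<delta> \<le> 0")
      case True
      moreover have "0 \<le> A n / n" using A_nn n0 by (simp add: divide_nonneg_pos)
      ultimately show ?thesis by linarith
    next
      case False
      have "\<bar>A (r * 2 ^ i) / (real r * 2 ^ i) - \<mu>\<bar> < \<delta>"
        using i0[of i r] i rN r1 by simp
      moreover have "\<mu> - \<delta> \<le> x" if "\<bar>x - \<mu>\<bar> < \<delta>" for x using that by linarith
      ultimately have "\<mu> - \<delta> \<le> A (r * 2 ^ i) / (real r * 2 ^ i)" by blast
      then have "(\<mu> - \<delta>) * (real r * 2 ^ i) \<le> A (r * 2 ^ i)"
        using r1 by (subst (asm) pos_le_divide_eq) auto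
      then have 1: "(\<mu> - \<delta>) * (real r * 2 ^ i) \<le> A n"
        using A_mono[OF r(1)] by linarith
      have "(\<mu> - 2 * \<delta>) * n \<le> (\<mu> - 2 * \<delta>) * ((real r + 1) * 2 ^ i)"
        using False nr by (intro mult_left_mono) auto
      also have "\<dots> = ((\<mu> - \<delta>) * r + (\<mu> - 2 * \<delta> - \<delta> * r)) * 2 ^ i" by (simp add: algebra_simps)
      also have "\<dots> \<le> ((\<mu> - \<delta>) * r + 0) * 2 ^ i"
        using \<delta>r \<delta> by (intro mult_right_mono add_left_mono) auto
      finally have "(\<mu> - 2 * \<delta>) * n \<le> A n" using 1 by (simp add: mult.assoc)
      then show ?thesis using n0 by (simp add: pos_le_divide_eq)
    qed
    show "norm ((\<Sum>j=1..n. Y j) / n - \<mu>) < \<epsilon>"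
      using up low \<delta> unfolding A_def[symmetric] \<delta>_def by (simp add: abs_less_iff)
  qed
qed

context phi_mixing
begin

lemma expectation_ident:
  fixes f :: "real \<Rightarrow> real"
  assumes "f \<in> borel_measurable borel" "j \<ge> 1"
  shows "expectation (\<lambda>w. f (X j w)) = expectation (\<lambda>w. f (X 1 w))"
  using integral_distr[OF rv[OF assms(2)] assms(1)] integral_distr[OF rv[of 1] assms(1)] ident[OF assms(2)]
  by simp

lemma AE_ident:
  assumes "AE w in M. P (X 1 w)" "{x. P x} \<in> sets borel" "j \<ge> 1"
  shows "AE w in M. P (X j w)"
proof -
  have "AE x in distr M borel (X j). P x"
    unfolding ident[OF assms(3)] using assms(1,2) by (subst AE_distr_iff) (auto intro: rv)
  then show ?thesis
    using assms(2) by (subst (asm) AE_distr_iff) (auto intro: rv[OF assms(3)])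
qed

lemma strong_law_along_dyadic_multiples:
  fixes g :: "real \<Rightarrow> real"
  assumes g [measurable]: "g \<in> borel_measurable borel" and g0: "\<And>x. g x \<ge> 0"
    and int: "integrable M (\<lambda>w. g (X 1 w))" and r: "r \<ge> 1"
  shows "AE w in M. (\<lambda>i. (\<Sum>j=1..r * 2 ^ i. g (X j w)) / (r * 2 ^ i)) \<longlonglongrightarrow> expectation (\<lambda>w. g (X 1 w))"
proof -
  obtain C where C: "C \<ge> 0" "\<And>Z K \<sigma> r i. centered_functionals M X Z K \<sigma> \<Longrightarrow>
    expectation (\<lambda>w. (\<Sum>j=1..r * 2 ^ i. Z j w)\<^sup>2) \<le> C * (real r)\<^sup>2 * 2 ^ i * \<sigma>\<^sup>2"
    using second_moment_bound by blast
  \<comment> \<open>The number of summands, which is also the truncation level.\<close>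
  define k where "k i = real r * 2 ^ i" for i
  define T where "T i x = min (g x) (k i)" for i x
  define \<mu> where "\<mu> i = expectation (\<lambda>w. T i (X 1 w))" for i
  define e where "e i = expectation (\<lambda>w. (T i (X 1 w))\<^sup>2)" for i
  have k: "k i \<ge> 1" "k i > 0" "k i \<ge> 2 ^ i" for i
  proof -
    have "1 * 1 \<le> real r * 2 ^ i" using r by (intro mult_mono) auto
    then show "k i \<ge> 1" by (simp add: k_def)
    then show "k i > 0" by linarith
    show "k i \<ge> 2 ^ i" using r unfolding k_def by (simp add: mult_le_cancel_right1)
  qed
  have [measurable]: "T i \<in> borel_measurable borel" for i unfolding T_def by measurable
  have T: "0 \<le> T i x" "T i x \<le> k i" "\<bar>T i x\<bar> \<le> k i" for i x
    using g0[of x] k[of i] by (auto simp: T_def)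
  have rvj [measurable]: "X j \<in> borel_measurable M" if "j \<ge> 1" for j using rv that .
  have T_int: "integrable M (\<lambda>w. T i (X j w))" if "j \<ge> 1" for i j
    by (rule integrable_const_bound[where B="k i"]) (use that T in auto)
  have T2_int: "integrable M (\<lambda>w. (T i (X j w))\<^sup>2)" if "j \<ge> 1" for i j
    by (rule integrable_const_bound[where B="(k i)\<^sup>2"]) (use that T in \<open>auto intro!: power_mono\<close>)
  have e_nn: "e i \<ge> 0" for i unfolding e_def by (rule Bochner_Integration.integral_nonneg) simp
  have ej: "expectation (\<lambda>w. (T i (X j w))\<^sup>2) = e i" if "j \<ge> 1" for i j
    unfolding e_def by (rule expectation_ident[of "\<lambda>x. (T i x)\<^sup>2"]) (use that in auto)
  have \<mu>j: "expectation (\<lambda>w. T i (X j w)) = \<mu> i" if "j \<ge> 1" for i j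
    unfolding \<mu>_def by (rule expectation_ident) (use that in auto)
  have \<mu>_bd: "0 \<le> \<mu> i" "\<mu> i \<le> k i" for i
  proof -
    show "0 \<le> \<mu> i" unfolding \<mu>_def by (rule Bochner_Integration.integral_nonneg) (rule T)
    have "\<mu> i \<le> expectation (\<lambda>w. k i)" unfolding \<mu>_def
      by (rule integral_mono) (auto intro!: T_int T)
    then show "\<mu> i \<le> k i" by (simp add: prob_space)
  qed
  \<comment> \<open>Adding 1 keeps the deviation bound positive when \<open>e i\<close> is 0; it
    costs only a multiple of (1/2)^i in the series below.\<close>
  have cf: "centered_functionals M X (\<lambda>j w. T i (X j w) - \<mu> i) (k i) (sqrt (e i + 1))" for i
  proof
    fix j :: nat assume j: "j \<ge> 1"
    have "X j \<in> borel_measurable (gen_alg M X {j})" by (rule measurable_gen_alg) simp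
    then show "(\<lambda>w. T i (X j w) - \<mu> i) \<in> borel_measurable (gen_alg M X {j})" by measurable
    show "\<bar>T i (X j w) - \<mu> i\<bar> \<le> k i" for w using T[of i "X j w"] \<mu>_bd[of i] by linarith
    show "expectation (\<lambda>w. T i (X j w) - \<mu> i) = 0"
      using T_int[OF j, of i] by (simp add: \<mu>j[OF j] prob_space)
    have "expectation (\<lambda>w. (T i (X j w) - \<mu> i)\<^sup>2) = e i - (\<mu> i)\<^sup>2"
      using variance_eq[OF T_int[OF j] T2_int[OF j], of i] by (simp add: \<mu>j[OF j] ej[OF j])
    then show "expectation (\<lambda>w. (T i (X j w) - \<mu> i)\<^sup>2) \<le> (sqrt (e i + 1))\<^sup>2"
      using e_nn[of i] by (simp add: add_nonneg_nonneg add_increasing2)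
  qed (use e_nn[of i] in simp)
  have e_sum: "summable (\<lambda>i. e i / 2 ^ i)"
  proof (rule summableI_nonneg_bounded)
    fix N
    have "(\<Sum>i<N. e i / 2 ^ i) = expectation (\<lambda>w. \<Sum>i<N. (T i (X 1 w))\<^sup>2 / 2 ^ i)"
      unfolding e_def using T2_int[of 1] by (subst Bochner_Integration.integral_sum) auto
    also have "\<dots> \<le> expectation (\<lambda>w. (real r)\<^sup>2 * (4 * g (X 1 w)))"
    proof (rule integral_mono)
      fix w
      \<comment> \<open>Truncation at r * 2^i is compared with truncation at 2^i, where the
        pointwise bound on the series applies; the price is the fixed factor r^2.\<close>
      have *: "(T i (X 1 w))\<^sup>2 \<le> (real r)\<^sup>2 * (min (g (X 1 w)) (2 ^ i))\<^sup>2" for i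
      proof -
        have "1 * g (X 1 w) \<le> real r * g (X 1 w)" using r g0 by (intro mult_right_mono) auto
        then have "T i (X 1 w) \<le> real r * min (g (X 1 w)) (2 ^ i)"
          unfolding T_def k_def by (auto simp: min_def)
        then have "(T i (X 1 w))\<^sup>2 \<le> (real r * min (g (X 1 w)) (2 ^ i))\<^sup>2"
          by (rule power_mono) (rule T)
        then show ?thesis by (simp add: power_mult_distrib)
      qed
      have "(\<Sum>i<N. (T i (X 1 w))\<^sup>2 / 2 ^ i) \<le> (\<Sum>i<N. (real r)\<^sup>2 * (min (g (X 1 w)) (2 ^ i))\<^sup>2 / 2 ^ i)"
        by (intro sum_mono divide_right_mono *) auto
      also have "\<dots> = (real r)\<^sup>2 * (\<Sum>i<N. (min (g (X 1 w)) (2 ^ i))\<^sup>2 / 2 ^ i)"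
        by (simp add: sum_distrib_left)
      also have "\<dots> \<le> (real r)\<^sup>2 * (4 * g (X 1 w))"
        by (intro mult_left_mono sum_truncated_squares_le g0) auto
      finally show "(\<Sum>i<N. (T i (X 1 w))\<^sup>2 / 2 ^ i) \<le> (real r)\<^sup>2 * (4 * g (X 1 w))" .
    qed (use T2_int[of 1] int in auto)
    finally show "(\<Sum>i<N. e i / 2 ^ i) \<le> expectation (\<lambda>w. (real r)\<^sup>2 * (4 * g (X 1 w)))" .
  qed (simp add: e_nn)
  have kn: "real (r * 2 ^ i) = k i" for i by (simp add: k_def)
  have ae1: "AE w in M. \<forall>\<^sub>F i in sequentially. w \<in> space M - {w\<in>space M. \<exists>j\<in>{1..r * 2 ^ i}. g (X j w) > k i}"
  proof (rule borel_cantelli_AE1)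
    fix i
    show "{w \<in> space M. \<exists>j\<in>{1..r * 2 ^ i}. k i < g (X j w)} \<in> sets M"
      by (rule sets.sets_Collect_finite_Ex) (auto intro!: borel_measurable_less)
    show "emeasure M {w \<in> space M. \<exists>j\<in>{1..r * 2 ^ i}. k i < g (X j w)} < \<infinity>"
      by (simp add: less_top[symmetric])
  next
    have "measure M {w \<in> space M. \<exists>j\<in>{1..r * 2 ^ i}. k i < g (X j w)} \<le> e i / 2 ^ i" for i
    proof -
      \<comment> \<open>Beyond the level \<open>k i\<close> the truncated variable equals
        \<open>k i\<close>, so its second moment controls the truncation event too; summing over
        \<open>k i\<close> indices leaves \<open>e i / k i\<close>. Thus the series of
        \<open>e i / 2 ^ i\<close> carries both uses of Borel-Cantelli.\<close>
      have one: "measure M {w\<in>space M. k i < g (X j w)} \<le> e i / (k i)\<^sup>2" if j: "j \<ge> 1" for j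
      proof -
        have "measure M {w\<in>space M. k i < g (X j w)} \<le> measure M {w\<in>space M. \<bar>T i (X j w)\<bar> \<ge> k i}"
          using j by (intro finite_measure_mono) (auto simp: T_def)
        also have "\<dots> \<le> e i / (k i)\<^sup>2"
          using second_moment_method[of "\<lambda>w. T i (X j w)" "k i"] T2_int[OF j] j k by (simp add: ej)
        finally show ?thesis .
      qed
      have "{w \<in> space M. \<exists>j\<in>{1..r * 2 ^ i}. k i < g (X j w)} = (\<Union>j\<in>{1..r * 2 ^ i}. {w\<in>space M. k i < g (X j w)})"
        by auto
      then have "measure M {w \<in> space M. \<exists>j\<in>{1..r * 2 ^ i}. k i < g (X j w)}
          \<le> (\<Sum>j\<in>{1..r * 2 ^ i}. measure M {w\<in>space M. k i < g (X j w)})"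
        by (simp only:) (rule finite_measure_subadditive_finite, auto intro!: borel_measurable_less)
      also have "\<dots> \<le> (\<Sum>j\<in>{1..r * 2 ^ i}. e i / (k i)\<^sup>2)"
        by (intro sum_mono one) auto
      also have "\<dots> = k i * (e i / (k i)\<^sup>2)" by (simp add: kn[symmetric])
      also have "\<dots> = e i / k i" using k(2)[of i] by (simp add: power2_eq_square)
      also have "\<dots> \<le> e i / 2 ^ i" using k e_nn by (intro divide_left_mono) (auto intro!: mult_pos_pos)
      finally show ?thesis .
    qed
    then show "summable (\<lambda>i. measure M {w \<in> space M. \<exists>j\<in>{1..r * 2 ^ i}. k i < g (X j w)})"
      by (intro summable_comparison_test'[OF e_sum, where N=0]) auto
  qed
  \<comment> \<open>The accuracies 1 / (N + 1) are countably many, so one null set serves all of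
    them.\<close>
  have ae2: "AE w in M. \<forall>N. \<forall>\<^sub>F i in sequentially.
     w \<in> space M - {w\<in>space M. \<bar>\<Sum>j=1..r * 2 ^ i. T i (X j w) - \<mu> i\<bar> \<ge> k i / real (Suc N)}"
    unfolding AE_all_countable
  proof (intro allI borel_cantelli_AE1)
    fix N i
    show "{w\<in>space M. \<bar>\<Sum>j=1..r * 2 ^ i. T i (X j w) - \<mu> i\<bar> \<ge> k i / real (Suc N)} \<in> sets M"
      by (rule borel_measurable_le) (auto intro!: borel_measurable_sum borel_measurable_abs)
    show "emeasure M {w\<in>space M. \<bar>\<Sum>j=1..r * 2 ^ i. T i (X j w) - \<mu> i\<bar> \<ge> k i / real (Suc N)} < \<infinity>"
      by (simp add: less_top[symmetric])
  next
    fix N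
    have "measure M {w\<in>space M. \<bar>\<Sum>j=1..r * 2 ^ i. T i (X j w) - \<mu> i\<bar> \<ge> k i / real (Suc N)}
        \<le> C * (real (Suc N))\<^sup>2 * (e i / 2 ^ i + (1/2) ^ i)" for i
    proof -
      interpret Z: centered_functionals M X "\<lambda>j w. T i (X j w) - \<mu> i" "k i" "sqrt (e i + 1)" by (rule cf)
      have eq: "(\<lambda>w. \<Sum>j=1..r * 2 ^ i. T i (X j w) - \<mu> i) = Z.S 0 (r * 2 ^ i)"
        unfolding Z.S_def by (simp add: atLeastSucAtMost_greaterThanAtMost[of 0, symmetric])
      have "measure M {w\<in>space M. \<bar>\<Sum>j=1..r * 2 ^ i. T i (X j w) - \<mu> i\<bar> \<ge> k i / real (Suc N)}
         \<le> expectation (\<lambda>w. (\<Sum>j=1..r * 2 ^ i. T i (X j w) - \<mu> i)\<^sup>2) / (k i / real (Suc N))\<^sup>2"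
        by (rule second_moment_method)
           (use k[of i] Z.S_measurable[of 0 "r * 2 ^ i"] Z.S_sq_integrable[of 0 "r * 2 ^ i"] in \<open>auto simp: eq[symmetric]\<close>)
      also have "\<dots> \<le> (C * (real r)\<^sup>2 * 2 ^ i * (sqrt (e i + 1))\<^sup>2) / (k i / real (Suc N))\<^sup>2"
        by (intro divide_right_mono C(2)[OF cf]) auto
      also have "\<dots> = C * (real (Suc N))\<^sup>2 * ((e i + 1) / 2 ^ i)"
        using r e_nn[of i] unfolding k_def
        by (simp add: power_divide power_mult_distrib add_nonneg_nonneg power2_eq_square[of "2 ^ i"])
      finally show ?thesis by (simp add: add_divide_distrib power_divide)
    qed
    then have bound: "norm (measure M {w\<in>space M. \<bar>\<Sum>j=1..r * 2 ^ i. T i (X j w) - \<mu> i\<bar> \<ge> k i / real (Suc N)})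
        \<le> C * (real (Suc N))\<^sup>2 * (e i / 2 ^ i + (1/2) ^ i)" for i
      unfolding real_norm_def abs_of_nonneg[OF measure_nonneg] .
    have "summable (\<lambda>i. C * (real (Suc N))\<^sup>2 * (e i / 2 ^ i + (1/2) ^ i))"
      by (rule summable_mult, rule summable_add, rule e_sum, rule summable_geometric, simp)
    then show "summable (\<lambda>i. measure M {w\<in>space M. \<bar>\<Sum>j=1..r * 2 ^ i. T i (X j w) - \<mu> i\<bar> \<ge> k i / real (Suc N)})"
      by (rule summable_comparison_test'[where N=0]) (rule bound)
  qed
  \<comment> \<open>The deviations above are measured from the truncated means; these tend to the
    true mean.\<close>
  have \<mu>_lim: "\<mu> \<longlonglongrightarrow> expectation (\<lambda>w. g (X 1 w))"
    unfolding \<mu>_def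
  proof (rule integral_dominated_convergence[OF _ _ int])
    show "AE w in M. (\<lambda>i. T i (X 1 w)) \<longlonglongrightarrow> g (X 1 w)"
    proof (rule AE_I2, rule tendsto_eventually)
      fix w
      obtain i0 where "g (X 1 w) < 2 ^ i0" using real_arch_pow[of 2 "g (X 1 w)"] by auto
      then have "T i (X 1 w) = g (X 1 w)" if "i \<ge> i0" for i
        using power_increasing[OF that, of "2::real"] k(3)[of i] unfolding T_def by (intro min_absorb1) linarith
      then show "\<forall>\<^sub>F i in sequentially. T i (X 1 w) = g (X 1 w)"
        unfolding eventually_sequentially by blast
    qed
    show "AE w in M. norm (T i (X 1 w)) \<le> g (X 1 w)" for i
      using T[of i] by (auto simp: T_def)
  qed auto
  from ae1 ae2 show ?thesis
  proof eventually_elim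
    case (elim w)
    have "(\<lambda>i. (\<Sum>j=1..r * 2 ^ i. g (X j w)) / k i - \<mu> i) \<longlonglongrightarrow> 0"
    proof (rule LIMSEQ_I)
      fix \<epsilon> :: real assume "\<epsilon> > 0"
      then obtain N where N: "inverse (real (Suc N)) < \<epsilon>" using reals_Archimedean by blast
      from elim(1) elim(2)[rule_format, of N]
      have "\<forall>\<^sub>F i in sequentially. norm ((\<Sum>j=1..r * 2 ^ i. g (X j w)) / k i - \<mu> i - 0) < \<epsilon>"
      proof eventually_elim
        case (elim i)
        have "(\<Sum>j=1..r * 2 ^ i. T i (X j w) - \<mu> i) = (\<Sum>j=1..r * 2 ^ i. g (X j w) - \<mu> i)"
          using elim(1) by (intro sum.cong refl) (auto simp: T_def not_less)
        also have "\<dots> = (\<Sum>j=1..r * 2 ^ i. g (X j w)) - k i * \<mu> i"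
          by (simp add: sum_subtractf kn[symmetric])
        finally have "\<bar>(\<Sum>j=1..r * 2 ^ i. g (X j w)) - k i * \<mu> i\<bar> < k i / real (Suc N)"
          using elim by auto
        then have "\<bar>(\<Sum>j=1..r * 2 ^ i. g (X j w)) - k i * \<mu> i\<bar> / k i < inverse (real (Suc N))"
          using k(2)[of i] by (subst pos_divide_less_eq) (auto simp: divide_inverse mult.commute)
        moreover have "\<bar>(\<Sum>j=1..r * 2 ^ i. g (X j w)) - k i * \<mu> i\<bar> / k i
           = \<bar>(\<Sum>j=1..r * 2 ^ i. g (X j w)) / k i - \<mu> i\<bar>"
        proof -
          have "(\<Sum>j=1..r * 2 ^ i. g (X j w)) / k i - \<mu> i = ((\<Sum>j=1..r * 2 ^ i. g (X j w)) - k i * \<mu> i) / k i"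
            using k(2)[of i] by (simp add: field_simps)
          then show ?thesis using k(2)[of i] by (simp add: abs_divide)
        qed
        ultimately show ?case using N by simp
      qed
      then show "\<exists>n0. \<forall>i\<ge>n0. norm ((\<Sum>j=1..r * 2 ^ i. g (X j w)) / k i - \<mu> i - 0) < \<epsilon>"
        unfolding eventually_sequentially .
    qed
    from tendsto_add[OF this \<mu>_lim] show ?case by (simp add: k_def)
  qed
qed

text \<open>Nonnegativity gives the monotone partial sums that fill the gaps. The functions to which
  the law is applied, indicators and powers of absolute values, are of this kind.\<close>

theorem strong_law:
  fixes g :: "real \<Rightarrow> real"
  assumes g: "g \<in> borel_measurable borel" and g0: "\<And>x. g x \<ge> 0"
    and int: "integrable M (\<lambda>w. g (X 1 w))"
  shows "AE w in M. (\<lambda>n. (\<Sum>j=1..n. g (X j w)) / n) \<longlonglongrightarrow> expectation (\<lambda>w. g (X 1 w))"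
proof -
  have "AE w in M. \<forall>r\<in>{1..}. (\<lambda>i. (\<Sum>j=1..r * 2 ^ i. g (X j w)) / real (r * 2 ^ i)) \<longlonglongrightarrow> expectation (\<lambda>w. g (X 1 w))"
    unfolding AE_ball_countable[OF countableI_type]
  proof
    fix r :: nat assume "r \<in> {1..}"
    then have "r \<ge> 1" by simp
    from strong_law_along_dyadic_multiples[OF g g0 int this]
    show "AE w in M. (\<lambda>i. (\<Sum>j=1..r * 2 ^ i. g (X j w)) / real (r * 2 ^ i)) \<longlonglongrightarrow> expectation (\<lambda>w. g (X 1 w))" .
  qed
  then show ?thesis
    by eventually_elim (rule average_tendsto_from_dyadic_multiples, auto simp: g0)
qed

end

section \<open>Order statistics and the unit interval\<close>

lemma card_filter_upt:
  "length (filter P (map f [1..<n+1])) = card {j\<in>{1..n}. P (f j)}"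
proof -
  have "length (filter P (map f [1..<n+1])) = length (filter (P \<circ> f) [1..<n+1])"
    by (simp only: filter_map length_map)
  also have "\<dots> = card ({j. (P \<circ> f) j} \<inter> set [1..<n+1])"
    by (rule distinct_length_filter) simp
  also have "{j. (P \<circ> f) j} \<inter> set [1..<n+1] = {j\<in>{1..n}. P (f j)}" by auto
  finally show ?thesis .
qed

text \<open>In a sorted list the entries satisfying a downward closed predicate form a prefix. A
  general predicate covers closed and open half-lines at once; atoms make both necessary.\<close>

lemma ord_stat_downward_closed_iff:
  assumes P: "\<And>x y. x \<le> y \<Longrightarrow> P y \<Longrightarrow> P x" and i: "1 \<le> i" "i \<le> n"
  shows "P (ord_stat X n i w) \<longleftrightarrow> i \<le> card {j\<in>{1..n}. P (X j w)}"
proof -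
  define xs where "xs = sort (map (\<lambda>j. X j w) [1..<n+1])"
  have len: "length xs = n" by (simp add: xs_def)
  have "length (filter P xs) = length (filter P (map (\<lambda>j. X j w) [1..<n+1]))"
    unfolding xs_def by (metis filter_sort length_sort)
  then have c: "card {j\<in>{1..n}. P (X j w)} = card {k. k < n \<and> P (xs ! k)}"
    using card_filter_upt[of P "\<lambda>j. X j w" n] by (simp add: length_filter_conv_card len)
  have mono: "xs ! k \<le> xs ! l" if "k \<le> l" "l < n" for k l
    using that len by (intro sorted_nth_mono) (auto simp: xs_def)
  have "P (xs ! (i - 1)) \<longleftrightarrow> i \<le> card {k. k < n \<and> P (xs ! k)}"
  proof
    assume Pi: "P (xs ! (i - 1))"
    have "{..<i} \<subseteq> {k. k < n \<and> P (xs ! k)}"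
    proof
      fix k assume "k \<in> {..<i}"
      then have "k \<le> i - 1" "i - 1 < n" "k < n" using i by auto
      then show "k \<in> {k. k < n \<and> P (xs ! k)}" using P[OF mono Pi] by auto
    qed
    from card_mono[OF _ this] show "i \<le> card {k. k < n \<and> P (xs ! k)}" by simp
  next
    assume le: "i \<le> card {k. k < n \<and> P (xs ! k)}"
    show "P (xs ! (i - 1))"
    proof (rule ccontr)
      assume nP: "\<not> P (xs ! (i - 1))"
      have "{k. k < n \<and> P (xs ! k)} \<subseteq> {..<i - 1}"
      proof
        fix k assume k: "k \<in> {k. k < n \<and> P (xs ! k)}"
        show "k \<in> {..<i - 1}"
        proof (rule ccontr)
          assume "k \<notin> {..<i - 1}"
          then have "xs ! (i - 1) \<le> xs ! k" using k by (intro mono) auto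
          then show False using P[of "xs ! (i - 1)" "xs ! k"] k nP by auto
        qed
      qed
      from card_mono[OF _ this] have "card {k. k < n \<and> P (xs ! k)} \<le> i - 1" by simp
      with le i show False by linarith
    qed
  qed
  then show ?thesis unfolding c ord_stat_def xs_def .
qed

text \<open>Sorting keeps the multiset. This turns an integral of f along the empirical quantile
  function into a sample average, to which the strong law applies.\<close>

lemma sum_ord_stat:
  fixes f :: "real \<Rightarrow> real"
  shows "(\<Sum>i=1..n. f (ord_stat X n i w)) = (\<Sum>j=1..n. f (X j w))"
proof -
  define ys where "ys = map (\<lambda>j. X j w) [1..<n+1]"
  have "(\<Sum>i=1..n. f (ord_stat X n i w)) = (\<Sum>k=0..<n. f (sort ys ! k))"
    unfolding ord_stat_def ys_def[symmetric]
    by (rule sum.reindex_bij_witness[of _ Suc "\<lambda>i. i - 1"]) auto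
  also have "\<dots> = sum_list (map f (sort ys))"
    by (simp add: sum_list_sum_nth ys_def)
  also have "\<dots> = sum_list (map f ys)"
    by (metis mset_map mset_sort sum_mset_sum_list)
  also have "\<dots> = (\<Sum>j=1..n. f (X j w))"
    unfolding ys_def map_map
    by (subst sum_list_distinct_conv_sum_set) (auto simp: comp_def atLeastLessThanSuc_atLeastAtMost simp del: upt_Suc)
  finally show ?thesis .
qed

lemma ord_stat_mem:
  assumes "1 \<le> i" "i \<le> n"
  shows "\<exists>j\<in>{1..n}. ord_stat X n i w = X j w"
proof -
  have "ord_stat X n i w \<in> set (sort (map (\<lambda>j. X j w) [1..<n+1]))"
    unfolding ord_stat_def using assms by (intro nth_mem) simp
  then show ?thesis by auto
qed

section \<open>The unit interval and its cells of length 1/n\<close>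

abbreviation unit_interval :: "real measure" where
  "unit_interval \<equiv> restrict_space lborel {0<..<1}"

lemma space_unit_interval [simp]: "space unit_interval = {0<..<1}"
  by (simp add: space_restrict_space)

interpretation unit_interval: prob_space unit_interval
  by (auto simp: space_restrict_space emeasure_restrict_space intro!: prob_spaceI)

text \<open>The interval integral ranges over the open interval, so it becomes an expectation under
  a probability measure.\<close>

lemma LBINT_unit_interval:
  fixes f :: "real \<Rightarrow> real"
  shows "(LBINT t=0..1. f t) = integral\<^sup>L unit_interval f"
  by (simp add: interval_lebesgue_integral_def set_lebesgue_integral_def integral_restrict_space
      zero_ereal_def one_ereal_def)

text \<open>The rank belonging to level t: \<open>ord_stat X n (cell n t) w\<close> is the empirical
  quantile function at t.\<close>

definition cell :: "nat \<Rightarrow> real \<Rightarrow> nat" where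
  "cell n t = nat \<lceil>t * real n\<rceil>"

lemma cell_measurable [measurable]: "cell n \<in> borel \<rightarrow>\<^sub>M count_space UNIV"
  unfolding cell_def by measurable

lemma cell_measurable' [measurable]: "cell n \<in> unit_interval \<rightarrow>\<^sub>M count_space UNIV"
  by (rule measurable_restrict_space1) simp

lemma cell_comp_measurable: "(\<lambda>t. \<phi> (cell n t) :: real) \<in> borel_measurable unit_interval"
  by (rule measurable_compose[OF cell_measurable']) simp

lemma cell_bounds:
  fixes t :: real
  assumes "0 < t" "t < 1" "n \<ge> 1"
  shows "1 \<le> cell n t" "cell n t \<le> n" "t * n \<le> cell n t" "cell n t < t * n + 1"
proof -
  have "t * n > 0" "t * n \<le> n" using assms by (auto intro!: mult_left_le_one_le)
  then show "1 \<le> cell n t" "cell n t \<le> n" "t * n \<le> cell n t" "cell n t < t * n + 1"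
    unfolding cell_def by linarith+
qed

lemma cell_eq_iff:
  fixes t :: real
  assumes "0 < t" "n \<ge> 1" "i \<ge> 1"
  shows "cell n t = i \<longleftrightarrow> (real i - 1) / n < t \<and> t \<le> i / n"
proof -
  have "t * n > 0" using assms by simp
  then have "cell n t = i \<longleftrightarrow> \<lceil>t * real n\<rceil> = int i"
    unfolding cell_def using assms by linarith
  also have "\<dots> \<longleftrightarrow> real i - 1 < t * n \<and> t * n \<le> i"
    by (auto simp: ceiling_eq_iff)
  also have "\<dots> \<longleftrightarrow> (real i - 1) / n < t \<and> t \<le> i / n"
    using assms by (simp add: field_simps)
  finally show ?thesis .
qed

lemma measure_cell:
  assumes n: "n \<ge> 1" and i: "1 \<le> i" "i \<le> n"
  shows "measure unit_interval (cell n -` {i} \<inter> {0<..<1}) = 1 / n"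
proof -
  \<comment> \<open>The last cell lacks its right endpoint 1, since the interval is open.\<close>
  have "cell n -` {i} \<inter> {0<..<1} = (if i = n then {(real i - 1) / n<..<1} else {(real i - 1) / n<..i / n})"
  proof (intro set_eqI)
    fix t
    have "t \<in> cell n -` {i} \<inter> {0<..<1} \<longleftrightarrow> 0 < t \<and> t < 1 \<and> (real i - 1) / n < t \<and> t \<le> i / n"
      using cell_eq_iff[OF _ n i(1), of t] by auto
    also have "\<dots> \<longleftrightarrow> t \<in> (if i = n then {(real i - 1) / n<..<1} else {(real i - 1) / n<..i / n})"
    proof -
      have "0 < t \<and> t < 1 \<and> u < t \<and> t \<le> v \<longleftrightarrow> t \<in> (if i = n then {u<..<1} else {u<..v})"
        if "u \<ge> 0" "i < n \<Longrightarrow> v < 1" "i = n \<Longrightarrow> v = 1" for u v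
        using that i by (cases "i = n") auto
      then show ?thesis using i n by simp
    qed
    finally show "t \<in> cell n -` {i} \<inter> {0<..<1} \<longleftrightarrow>
      t \<in> (if i = n then {(real i - 1) / n<..<1} else {(real i - 1) / n<..i / n})" .
  qed
  moreover have "measure lborel (if i = n then {(real i - 1) / n<..<1} else {(real i - 1) / n<..i / n}) = 1 / n"
    using n i by (auto simp: field_simps)
  moreover have "measure unit_interval (cell n -` {i} \<inter> {0<..<1}) = measure lborel (cell n -` {i} \<inter> {0<..<1})"
    by (rule measure_restrict_space) auto
  ultimately show ?thesis by simp
qed

lemma integral_cell:
  assumes n: "n \<ge> 1"
  shows "integral\<^sup>L unit_interval (\<lambda>t. \<phi> (cell n t)) = (\<Sum>i=1..n. \<phi> i) / n"
proof -
  have "integral\<^sup>L unit_interval (\<lambda>t. \<phi> (cell n t))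
     = (\<Sum>i\<in>{1..n}. \<phi> i * measure unit_interval (cell n -` {i} \<inter> space unit_interval))"
    by (rule unit_interval.expectation_finite_range)
       (use n cell_bounds measurable_sets[OF cell_measurable', of "{_}"] in auto)
  also have "\<dots> = (\<Sum>i\<in>{1..n}. \<phi> i * (1 / n))"
    by (intro sum.cong refl) (use measure_cell[OF n] in auto)
  finally show ?thesis by (simp add: sum_divide_distrib)
qed

lemma cell_bounded:
  assumes n: "n \<ge> 1"
  obtains B where "\<And>t. 0 < t \<Longrightarrow> t < 1 \<Longrightarrow> \<bar>\<phi> (cell n t) :: real\<bar> \<le> B"
proof
  fix t :: real assume "0 < t" "t < 1"
  with n show "\<bar>\<phi> (cell n t)\<bar> \<le> (\<Sum>i=1..n. \<bar>\<phi> i\<bar>)"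
    using cell_bounds[of t n] by (intro member_le_sum) auto
qed

lemma integrable_cell:
  assumes "n \<ge> 1"
  shows "integrable unit_interval (\<lambda>t. \<phi> (cell n t) :: real)"
proof -
  obtain B where B: "\<And>t. 0 < t \<Longrightarrow> t < 1 \<Longrightarrow> \<bar>\<phi> (cell n t)\<bar> \<le> B"
    using cell_bounded[OF assms] by blast
  show ?thesis
    by (rule unit_interval.integrable_const_bound[where B=B]) (use B in \<open>auto intro!: AE_I2 cell_comp_measurable\<close>)
qed

lemma integrable_cell_mult:
  fixes f :: "real \<Rightarrow> real"
  assumes n: "n \<ge> 1" and f: "integrable unit_interval f"
  shows "integrable unit_interval (\<lambda>t. \<phi> (cell n t) * f t)"
proof -
  obtain B where B: "\<And>t. 0 < t \<Longrightarrow> t < 1 \<Longrightarrow> \<bar>\<phi> (cell n t)\<bar> \<le> B"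
    using cell_bounded[OF n] by blast
  show ?thesis
  proof (rule Bochner_Integration.integrable_bound)
    show "integrable unit_interval (\<lambda>t. B * f t)" using f by simp
    show "(\<lambda>t. \<phi> (cell n t) * f t) \<in> borel_measurable unit_interval"
      using f by (intro borel_measurable_times cell_comp_measurable) auto
    show "AE t in unit_interval. norm (\<phi> (cell n t) * f t) \<le> norm (B * f t)"
    proof (rule AE_I2)
      fix t assume "t \<in> space unit_interval"
      then have "\<bar>\<phi> (cell n t)\<bar> \<le> B" using B by auto
      then show "norm (\<phi> (cell n t) * f t) \<le> norm (B * f t)"
        by (simp add: abs_mult mult_right_mono)
    qed
  qed
qed

lemma L_stat_minus_integral:
  assumes n: "n \<ge> 1" and H: "integrable unit_interval H"
  shows "L_stat c h X n w - (LBINT t=0..1. c_step c n t * H t)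
    = integral\<^sup>L unit_interval (\<lambda>t. c n (cell n t) * (h (ord_stat X n (cell n t) w) - H t))"
proof -
  have 1: "L_stat c h X n w = integral\<^sup>L unit_interval (\<lambda>t. c n (cell n t) * h (ord_stat X n (cell n t) w))"
    unfolding L_stat_def using integral_cell[OF n, of "\<lambda>i. c n i * h (ord_stat X n i w)"] by simp
  have 2: "(LBINT t=0..1. c_step c n t * H t) = integral\<^sup>L unit_interval (\<lambda>t. c n (cell n t) * H t)"
    unfolding LBINT_unit_interval
    by (rule Bochner_Integration.integral_cong) (auto simp: c_step_def cell_def)
  show ?thesis
    unfolding 1 2 right_diff_distrib
    using integrable_cell[OF n, of "\<lambda>i. c n i * h (ord_stat X n i w)"] integrable_cell_mult[OF n H]
    by (intro Bochner_Integration.integral_diff[symmetric]) auto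
qed

section \<open>Bounded continuous approximation in the p-norm\<close>

lemma approx_indicator_continuous:
  fixes \<mu> :: "real measure"
  assumes "finite_measure \<mu>" and sets: "sets \<mu> = sets borel" and A: "A \<in> sets borel" and \<eta>: "\<eta> > 0"
  shows "\<exists>g. continuous_on UNIV g \<and> (\<forall>x. \<bar>g x\<bar> \<le> 1) \<and> (\<integral>x. \<bar>indicator A x - g x\<bar> \<partial>\<mu>) < (\<eta>::real)"
proof -
  interpret finite_measure \<mu> by fact
  have sp: "space \<mu> = UNIV" using sets_eq_imp_space_eq[OF sets] by simp
  have fin: "emeasure \<mu> (space \<mu>) \<noteq> \<infinity>" using emeasure_finite by simp
  have inner: "\<exists>K. K \<subseteq> S \<and> compact K \<and> measure \<mu> S - \<eta> / 2 < measure \<mu> K" if "S \<in> sets borel" for S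
  proof -
    have "(SUP K\<in>{K. K \<subseteq> S \<and> compact K}. emeasure \<mu> K) = ennreal (measure \<mu> S)"
      using inner_regular[OF sets fin that] by (simp add: emeasure_eq_measure)
    moreover have "{K. K \<subseteq> S \<and> compact K} \<noteq> {}" by (auto intro!: exI[of _ "{}"])
    ultimately have "\<exists>K\<in>{K. K \<subseteq> S \<and> compact K}. ennreal (measure \<mu> S) < emeasure \<mu> K + ennreal (\<eta> / 2)"
      using SUP_approx_ennreal[of "\<eta>/2" "{K. K \<subseteq> S \<and> compact K}" "ennreal (measure \<mu> S)" "emeasure \<mu>"] \<eta> by auto
    then obtain K where K: "K \<subseteq> S" "compact K" "ennreal (measure \<mu> S) < emeasure \<mu> K + ennreal (\<eta> / 2)" by auto
    then have "measure \<mu> S < measure \<mu> K + \<eta> / 2"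
      using \<eta> by (auto simp: emeasure_eq_measure ennreal_less_iff simp flip: ennreal_plus)
    with K show ?thesis by (intro exI[of _ K]) auto
  qed
  obtain K where K: "K \<subseteq> A" "compact K" "measure \<mu> A - \<eta> / 2 < measure \<mu> K" using inner[OF A] by blast
  have "- A \<in> sets borel" using A by auto
  then obtain L where L: "L \<subseteq> - A" "compact L" "measure \<mu> (- A) - \<eta> / 2 < measure \<mu> L" using inner by blast
  have disj: "K \<inter> L = {}" using K(1) L(1) by auto
  \<comment> \<open>A Urysohn function for compact sets inside \<open>A\<close> and inside its
    complement. It can differ from the indicator only on \<open>A - K\<close> and
    \<open>- A - L\<close>, each of measure below \<eta> / 2.\<close>
  obtain g :: "real \<Rightarrow> real" where g: "continuous_on UNIV g" "\<And>x. g x \<in> closed_segment 1 0"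
      "\<And>x. x \<in> K \<Longrightarrow> g x = 1" "\<And>x. x \<in> L \<Longrightarrow> g x = 0"
    using Urysohn[OF compact_imp_closed[OF K(2)] compact_imp_closed[OF L(2)] disj, of "1::real" 0] by blast
  have g01: "0 \<le> g x" "g x \<le> 1" for x using g(2)[of x] by (auto simp: closed_segment_eq_real_ivl)
  have [measurable]: "g \<in> borel_measurable \<mu>"
    using borel_measurable_continuous_onI[OF g(1)] by (simp add: measurable_cong_sets[OF sets])
  have KB: "K \<in> sets \<mu>" "L \<in> sets \<mu>" "A \<in> sets \<mu>" "- A \<in> sets \<mu>"
    using K(2) L(2) A by (auto simp: sets intro: borel_compact)
  have "(\<integral>x. \<bar>indicator A x - g x\<bar> \<partial>\<mu>) \<le> (\<integral>x. indicator (A - K) x + indicator (- A - L) x \<partial>\<mu>)"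
  proof (rule integral_mono)
    show "integrable \<mu> (\<lambda>x. \<bar>indicator A x - g x\<bar>)"
    proof (rule integrable_const_bound[where B=1], rule AE_I2)
      fix x show "norm \<bar>indicator A x - g x\<bar> \<le> 1"
        using g01[of x] by (auto simp: indicator_def)
    qed (use KB in \<open>measurable\<close>)
    show "integrable \<mu> (\<lambda>x. indicator (A - K) x + indicator (- A - L) x :: real)"
      using KB by (intro Bochner_Integration.integrable_add integrable_real_indicator) (auto simp: less_top[symmetric])
    fix x show "\<bar>indicator A x - g x\<bar> \<le> indicator (A - K) x + indicator (- A - L) x"
      using g(3,4)[of x] g01[of x] K(1) L(1) by (auto simp: indicator_def abs_if)
  qed
  also have "\<dots> = measure \<mu> (A - K) + measure \<mu> (- A - L)"
    using KB by (subst Bochner_Integration.integral_add) (auto simp: less_top[symmetric] sp)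
  also have "\<dots> < \<eta>"
    using KB K L by (simp add: finite_measure_Diff)
  finally have "(\<integral>x. \<bar>indicator A x - g x\<bar> \<partial>\<mu>) < \<eta>" .
  moreover have "\<bar>g x\<bar> \<le> 1" for x using g01[of x] by auto
  ultimately show ?thesis using g(1) by blast
qed

lemma approx_L1_continuous:
  fixes \<mu> :: "real measure" and f :: "real \<Rightarrow> real"
  assumes fm: "finite_measure \<mu>" and sets: "sets \<mu> = sets borel" and f: "integrable \<mu> f" and \<eta>: "\<eta> > 0"
  shows "\<exists>g B. continuous_on UNIV g \<and> (\<forall>x. \<bar>g x\<bar> \<le> B) \<and> (\<integral>x. \<bar>f x - g x\<bar> \<partial>\<mu>) < \<eta>"
  using f \<eta>
proof (induction f arbitrary: \<eta> rule: integrable_induct)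
  case (base A c)
  obtain g where g: "continuous_on UNIV g" "\<And>x. \<bar>g x\<bar> \<le> 1"
      "(\<integral>x. \<bar>indicator A x - g x\<bar> \<partial>\<mu>) < \<eta> / (\<bar>c\<bar> + 1)"
    using approx_indicator_continuous[OF fm sets, of A "\<eta> / (\<bar>c\<bar> + 1)"] base sets by auto
  have "\<bar>indicator A x *\<^sub>R c - g x * c\<bar> = \<bar>c\<bar> * \<bar>indicator A x - g x\<bar>" for x
    by (simp add: abs_mult[symmetric] algebra_simps)
  then have "(\<integral>x. \<bar>indicator A x *\<^sub>R c - g x * c\<bar> \<partial>\<mu>) = (\<integral>x. \<bar>c\<bar> * \<bar>indicator A x - g x\<bar> \<partial>\<mu>)"
    by (simp only:)
  also have "\<dots> = \<bar>c\<bar> * (\<integral>x. \<bar>indicator A x - g x\<bar> \<partial>\<mu>)" by simp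
  also have "\<dots> \<le> (\<bar>c\<bar> + 1) * (\<integral>x. \<bar>indicator A x - g x\<bar> \<partial>\<mu>)"
    by (intro mult_right_mono Bochner_Integration.integral_nonneg) auto
  also have "\<dots> < \<eta>" using g(3) by (simp add: field_simps add_pos_nonneg)
  finally have "(\<integral>x. \<bar>indicator A x *\<^sub>R c - g x * c\<bar> \<partial>\<mu>) < \<eta>" .
  moreover have "\<bar>g x * c\<bar> \<le> \<bar>c\<bar>" for x
    using g(2)[of x] by (simp add: abs_mult mult_left_le_one_le)
  moreover have "continuous_on UNIV (\<lambda>x. g x * c)" by (intro continuous_intros g)
  ultimately show ?case by blast
next
  case (add f1 f2)
  obtain g1 B1 where g1: "continuous_on UNIV g1" "\<And>x. \<bar>g1 x\<bar> \<le> B1" "(\<integral>x. \<bar>f1 x - g1 x\<bar> \<partial>\<mu>) < \<eta> / 2"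
    using add.IH(1)[of "\<eta> / 2"] add.prems by auto
  obtain g2 B2 where g2: "continuous_on UNIV g2" "\<And>x. \<bar>g2 x\<bar> \<le> B2" "(\<integral>x. \<bar>f2 x - g2 x\<bar> \<partial>\<mu>) < \<eta> / 2"
    using add.IH(2)[of "\<eta> / 2"] add.prems by auto
  interpret finite_measure \<mu> by (rule fm)
  have m: "g1 \<in> borel_measurable \<mu>" "g2 \<in> borel_measurable \<mu>"
    using borel_measurable_continuous_onI[OF g1(1)] borel_measurable_continuous_onI[OF g2(1)]
    by (simp_all add: measurable_cong_sets[OF sets])
  have i: "integrable \<mu> g1" "integrable \<mu> g2"
    using m g1(2) g2(2) by (auto intro: integrable_const_bound[where B=B1] integrable_const_bound[where B=B2])
  have "(\<integral>x. \<bar>f1 x + f2 x - (g1 x + g2 x)\<bar> \<partial>\<mu>) \<le> (\<integral>x. \<bar>f1 x - g1 x\<bar> + \<bar>f2 x - g2 x\<bar> \<partial>\<mu>)"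
    using add.hyps i by (intro integral_mono) auto
  also have "\<dots> < \<eta>"
    using add.hyps i g1(3) g2(3) by (subst Bochner_Integration.integral_add) auto
  finally have "(\<integral>x. \<bar>f1 x + f2 x - (g1 x + g2 x)\<bar> \<partial>\<mu>) < \<eta>" .
  moreover have "\<bar>g1 x + g2 x\<bar> \<le> B1 + B2" for x using g1(2)[of x] g2(2)[of x] by linarith
  moreover have "continuous_on UNIV (\<lambda>x. g1 x + g2 x)" by (intro continuous_intros g1 g2)
  ultimately show ?case by blast
next
  case (lim f s)
  have "(\<lambda>i. \<integral>x. \<bar>f x - s i x\<bar> \<partial>\<mu>) \<longlonglongrightarrow> (\<integral>x. 0 \<partial>\<mu>)"
  proof (rule integral_dominated_convergence[where w="\<lambda>x. 3 * \<bar>f x\<bar>"])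
    show "AE x in \<mu>. (\<lambda>i. \<bar>f x - s i x\<bar>) \<longlonglongrightarrow> 0"
      using tendsto_rabs_zero[OF LIM_zero[OF lim.hyps(2)]] by (auto simp: abs_minus_commute)
    show "AE x in \<mu>. norm \<bar>f x - s i x\<bar> \<le> 3 * \<bar>f x\<bar>" for i
    proof (rule AE_I2)
      fix x assume "x \<in> space \<mu>"
      from lim.hyps(3)[OF this, of i] show "norm \<bar>f x - s i x\<bar> \<le> 3 * \<bar>f x\<bar>" by simp
    qed
  qed (use lim.hyps in auto)
  then have "\<forall>\<^sub>F i in sequentially. (\<integral>x. \<bar>f x - s i x\<bar> \<partial>\<mu>) < \<eta> / 2"
    using lim.prems by (intro order_tendstoD(2)) auto
  then obtain i where i: "(\<integral>x. \<bar>f x - s i x\<bar> \<partial>\<mu>) < \<eta> / 2"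
    by (auto simp: eventually_sequentially)
  obtain g B where g: "continuous_on UNIV g" "\<And>x. \<bar>g x\<bar> \<le> B" "(\<integral>x. \<bar>s i x - g x\<bar> \<partial>\<mu>) < \<eta> / 2"
    using lim.IH[of "\<eta> / 2" i] lim.prems by auto
  interpret finite_measure \<mu> by (rule fm)
  have m: "g \<in> borel_measurable \<mu>"
    using borel_measurable_continuous_onI[OF g(1)] by (simp_all add: measurable_cong_sets[OF sets])
  have ig: "integrable \<mu> g" using m g(2) by (auto intro: integrable_const_bound[where B=B])
  have "(\<integral>x. \<bar>f x - g x\<bar> \<partial>\<mu>) \<le> (\<integral>x. \<bar>f x - s i x\<bar> + \<bar>s i x - g x\<bar> \<partial>\<mu>)"
    using lim.hyps ig by (intro integral_mono) auto
  also have "\<dots> < \<eta>"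
    using lim.hyps ig i g(3) by (subst Bochner_Integration.integral_add) auto
  finally show ?case using g by blast
qed

text \<open>The sum is at most three times the largest term. Three terms are what the passage from h
  to a continuous function and back needs; the two-term case is obtained with z = 0.\<close>

lemma powr_sum3_le:
  fixes x y z p :: real
  assumes "x \<ge> 0" "y \<ge> 0" "z \<ge> 0" "p \<ge> 0"
  shows "(x + y + z) powr p \<le> 3 powr p * (x powr p + y powr p + z powr p)"
proof -
  define m where "m = max x (max y z)"
  have "(x + y + z) powr p \<le> (3 * m) powr p"
    using assms by (intro powr_mono2) (auto simp: m_def)
  also have "\<dots> = 3 powr p * m powr p"
    by (rule powr_mult)
  also have "m powr p \<le> x powr p + y powr p + z powr p"
  proof -
    have "m = x \<or> m = y \<or> m = z" by (auto simp: m_def max_def)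
    then show ?thesis by (elim disjE) simp_all
  qed
  finally show ?thesis by simp
qed

text \<open>Clipping reduces the problem to a bounded function. For differences y in [0, D] with D
  >= 1, y^p is at most D^p * y, so closeness in the 1-norm gives closeness in the p-norm.\<close>

lemma approx_Lp_continuous:
  fixes \<mu> :: "real measure" and f :: "real \<Rightarrow> real"
  assumes fm: "finite_measure \<mu>" and sets: "sets \<mu> = sets borel" and p: "p \<ge> 1"
    and f [measurable]: "f \<in> borel_measurable borel" and fi: "integrable \<mu> (\<lambda>x. \<bar>f x\<bar> powr p)" and \<eta>: "\<eta> > 0"
  shows "\<exists>g B. continuous_on UNIV g \<and> (\<forall>x. \<bar>g x\<bar> \<le> B) \<and> (\<integral>x. \<bar>f x - g x\<bar> powr p \<partial>\<mu>) < \<eta>"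
proof -
  interpret finite_measure \<mu> by (rule fm)
  note [measurable_cong] = sets
  define clip :: "real \<Rightarrow> real \<Rightarrow> real" where "clip N x = max (- N) (min N x)" for N x
  have [measurable]: "clip N \<in> borel_measurable borel" for N unfolding clip_def by measurable
  have clip: "\<bar>clip N x\<bar> \<le> N" "\<bar>clip N x - clip N y\<bar> \<le> \<bar>x - y\<bar>" "\<bar>x - clip N x\<bar> \<le> \<bar>x\<bar>" "clip N (clip N x) = clip N x"
    if "N \<ge> 0" for N x y using that unfolding clip_def by (auto simp: max_def min_def)
  define \<eta>' where "\<eta>' = \<eta> / (2 * 3 powr p)"
  have \<eta>': "\<eta>' > 0" using \<eta> by (simp add: \<eta>'_def)
  have "(\<lambda>N. \<integral>x. \<bar>f x - clip (real N) (f x)\<bar> powr p \<partial>\<mu>) \<longlonglongrightarrow> (\<integral>x. 0 \<partial>\<mu>)"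
  proof (rule integral_dominated_convergence[OF _ _ fi])
    show "AE x in \<mu>. (\<lambda>N. \<bar>f x - clip (real N) (f x)\<bar> powr p) \<longlonglongrightarrow> 0"
    proof (rule AE_I2, rule tendsto_eventually)
      fix x
      obtain N0 :: nat where "\<bar>f x\<bar> \<le> N0" using real_arch_simple by blast
      then have "\<bar>f x - clip (real N) (f x)\<bar> powr p = 0" if "N \<ge> N0" for N
        using that by (auto simp: clip_def max_def min_def)
      then show "\<forall>\<^sub>F N in sequentially. \<bar>f x - clip (real N) (f x)\<bar> powr p = 0"
        unfolding eventually_sequentially by blast
    qed
    show "AE x in \<mu>. norm (\<bar>f x - clip (real N) (f x)\<bar> powr p) \<le> \<bar>f x\<bar> powr p" for N
      using p clip(3)[of "real N"] by (auto intro!: powr_mono2)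
  qed measurable
  then have "\<forall>\<^sub>F N in sequentially. (\<integral>x. \<bar>f x - clip (real N) (f x)\<bar> powr p \<partial>\<mu>) < \<eta>'"
    using \<eta>' by (intro order_tendstoD(2)) auto
  then obtain N :: nat where N: "(\<integral>x. \<bar>f x - clip (real N) (f x)\<bar> powr p \<partial>\<mu>) < \<eta>'"
    by (auto simp: eventually_sequentially)
  \<comment> \<open>2 N bounds the difference of two values clipped to [-N, N]; the added 1 ensures
    D >= 1.\<close>
  define D :: real where "D = 2 * N + 1"
  have D: "D \<ge> 1" by (simp add: D_def)
  have ci: "integrable \<mu> (\<lambda>x. clip N (f x))"
    by (rule integrable_const_bound[where B="real N"]) (use clip(1)[of "real N"] in auto)
  obtain g0 B where g0: "continuous_on UNIV g0" "(\<integral>x. \<bar>clip N (f x) - g0 x\<bar> \<partial>\<mu>) < \<eta>' / D powr p"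
      "\<And>x. \<bar>g0 x\<bar> \<le> B"
    using approx_L1_continuous[OF fm sets ci, of "\<eta>' / D powr p"] \<eta>' D by auto
  have [measurable]: "g0 \<in> borel_measurable borel"
    by (rule borel_measurable_continuous_onI[OF g0(1)])
  have g0i: "integrable \<mu> g0"
    by (rule integrable_const_bound[where B=B]) (use g0(3) in auto)
  \<comment> \<open>Clipping the approximant keeps it continuous and brings it no farther from the
    clipped f, as \<open>clip\<close> is 1-Lipschitz and idempotent.\<close>
  define g where "g x = clip N (g0 x)" for x
  have [measurable]: "g \<in> borel_measurable borel" unfolding g_def by measurable
  have g: "continuous_on UNIV g" unfolding g_def clip_def by (intro continuous_intros g0)
  have gB: "\<bar>g x\<bar> \<le> N" for x unfolding g_def by (rule clip) simp
  have i1: "integrable \<mu> (\<lambda>x. \<bar>f x - clip N (f x)\<bar> powr p)"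
    by (rule Bochner_Integration.integrable_bound[OF fi])
       (use p clip(3)[of "real N"] in \<open>auto intro!: powr_mono2\<close>)
  have i2: "integrable \<mu> (\<lambda>x. \<bar>clip N (f x) - g0 x\<bar>)" using ci g0i by auto
  have pw: "\<bar>f x - g x\<bar> powr p \<le> 3 powr p * (\<bar>f x - clip N (f x)\<bar> powr p + D powr p * \<bar>clip N (f x) - g0 x\<bar>)" for x
  proof -
    have "\<bar>f x - g x\<bar> powr p \<le> (\<bar>f x - clip N (f x)\<bar> + \<bar>clip N (f x) - g x\<bar> + 0) powr p"
      using p by (intro powr_mono2) auto
    also have "\<dots> \<le> 3 powr p * (\<bar>f x - clip N (f x)\<bar> powr p + \<bar>clip N (f x) - g x\<bar> powr p + 0 powr p)"
      using p by (intro powr_sum3_le) auto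
    also have "\<bar>clip N (f x) - g x\<bar> powr p \<le> D powr p * \<bar>clip N (f x) - g0 x\<bar>"
    proof -
      define y where "y = \<bar>clip N (f x) - g x\<bar>"
      have y: "0 \<le> y" "y \<le> D" using clip(1)[of "real N" "f x"] gB[of x] by (auto simp: y_def D_def)
      have "y powr p = D powr p * (y / D) powr p"
        using y D by (simp add: powr_mult[symmetric])
      also have "(y / D) powr p \<le> (y / D) powr 1"
        using y D p by (intro powr_mono') auto
      also have "(y / D) powr 1 \<le> y" using y D mult_left_mono[of 1 D y] by (simp add: divide_le_eq)
      also have "y \<le> \<bar>clip N (f x) - g0 x\<bar>"
        using clip(2)[of "real N" "clip N (f x)" "g0 x"] clip(4)[of "real N" "f x"] by (simp add: y_def g_def)
      finally show ?thesis by (simp add: y_def mult_left_mono)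
    qed
    finally show ?thesis using p by simp
  qed
  have "(\<integral>x. \<bar>f x - g x\<bar> powr p \<partial>\<mu>) \<le> (\<integral>x. 3 powr p * (\<bar>f x - clip N (f x)\<bar> powr p + D powr p * \<bar>clip N (f x) - g0 x\<bar>) \<partial>\<mu>)"
    by (rule integral_mono') (use i1 i2 pw in auto)
  also have "\<dots> = 3 powr p * ((\<integral>x. \<bar>f x - clip N (f x)\<bar> powr p \<partial>\<mu>) + D powr p * (\<integral>x. \<bar>clip N (f x) - g0 x\<bar> \<partial>\<mu>))"
    using i1 i2 by simp
  also have "\<dots> < 3 powr p * (\<eta>' + D powr p * (\<eta>' / D powr p))"
    using N g0(2) D by (intro mult_strict_left_mono add_strict_mono) auto
  also have "\<dots> = \<eta>" using D by (simp add: \<eta>'_def)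
  finally show ?thesis using g gB by blast
qed

section \<open>Convergence of the empirical quantile function\<close>

context phi_mixing
begin

text \<open>The Skorokhod construction for a single law: it supplies the Galois connection between
  quantile function and distribution function, and the fact that the quantile function carries
  Lebesgue measure on (0,1) to the law.\<close>

interpretation law: cdf_distribution "distr M borel (X 1)"
  unfolding cdf_distribution_def by (rule real_distribution_distr) (rule rv, simp)

definition F :: "real \<Rightarrow> real" where
  "F = (\<lambda>x. measure M {w\<in>space M. X 1 w \<le> x})"

definition Q :: "real \<Rightarrow> real" where
  "Q = quantile F"

lemma rv1: "X 1 \<in> borel_measurable M"
  by (rule rv) simp

lemma cdf_law: "cdf (distr M borel (X 1)) = F"
proof
  fix x
  have "X 1 -` {..x} \<inter> space M = {w\<in>space M. X 1 w \<le> x}" by auto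
  then show "cdf (distr M borel (X 1)) x = F x"
    unfolding cdf_def F_def by (subst measure_distr) (simp_all only: rv1 atMost_borel)
qed

lemma Q_eq: "Q = (\<lambda>s. Inf {x. s \<le> cdf (distr M borel (X 1)) x})"
  unfolding Q_def quantile_def cdf_law ..

lemma Q_le_iff: "0 < s \<Longrightarrow> s < 1 \<Longrightarrow> Q s \<le> x \<longleftrightarrow> s \<le> F x"
  using law.pseudoinverse[of s x] unfolding Q_eq cdf_law by auto

lemma Q_mono_on: "mono_on {0<..<1} Q"
  using law.mono_I unfolding Q_eq .

lemma Q_mono: "0 < s \<Longrightarrow> s \<le> t \<Longrightarrow> t < 1 \<Longrightarrow> Q s \<le> Q t"
  using Q_mono_on by (auto simp: mono_on_def)

lemma Q_measurable [measurable]: "Q \<in> borel_measurable unit_interval"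
  using law.measurable_CI unfolding Q_eq
  by (simp add: measurable_cong_sets[OF sets_restrict_space_cong[OF sets_lborel] refl])

lemma distr_Q: "distr unit_interval borel Q = distr M borel (X 1)"
  using law.distr_I_eq_M unfolding Q_eq .

lemma F_measurable [measurable]: "F \<in> borel_measurable borel"
  using law.measurable_C unfolding cdf_law .

lemma F_bounds: "0 \<le> F x" "F x \<le> 1"
  by (auto simp: F_def)

lemma integral_Q:
  fixes f :: "real \<Rightarrow> real"
  assumes "f \<in> borel_measurable borel"
  shows "integral\<^sup>L unit_interval (\<lambda>t. f (Q t)) = expectation (\<lambda>w. f (X 1 w))"
  using integral_distr[OF Q_measurable assms] integral_distr[OF rv1 assms] unfolding distr_Q by simp

lemma integrable_law_iff:
  fixes f :: "real \<Rightarrow> real"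
  assumes "f \<in> borel_measurable borel"
  shows "integrable (distr M borel (X 1)) f \<longleftrightarrow> integrable M (\<lambda>w. f (X 1 w))"
  by (rule integrable_distr_eq[OF rv1 assms])

lemma integrable_Q_iff:
  fixes f :: "real \<Rightarrow> real"
  assumes "f \<in> borel_measurable borel"
  shows "integrable unit_interval (\<lambda>t. f (Q t)) \<longleftrightarrow> integrable M (\<lambda>w. f (X 1 w))"
  unfolding integrable_law_iff[OF assms, symmetric] distr_Q[symmetric]
  by (rule integrable_distr_eq[OF Q_measurable assms, symmetric])

text \<open>The law is the image of Lebesgue measure under \<open>Q\<close>, so what holds at all
  values of \<open>Q\<close> holds almost surely, even if \<open>Q\<close> omits part of the
  line.\<close>

lemma AE_from_Q:
  assumes "{x. P x} \<in> sets borel" "\<And>t. 0 < t \<Longrightarrow> t < 1 \<Longrightarrow> P (Q t)"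
  shows "AE w in M. P (X 1 w)"
proof -
  have "AE x in distr unit_interval borel Q. P x"
    using assms by (subst AE_distr_iff[OF Q_measurable]) (auto intro!: AE_I2)
  then show ?thesis
    unfolding distr_Q using assms(1) by (subst (asm) AE_distr_iff[OF rv1]) auto
qed

lemma AE_isCont_Q: "AE t in unit_interval. isCont Q t"
proof -
  have "countable {t\<in>{0<..<1}. \<not> isCont Q t}"
    by (rule mono_on_ctble_discont_open[OF _ Q_mono_on]) simp
  then have "{t\<in>{0<..<1}. \<not> isCont Q t} \<in> null_sets lborel"
    by (rule countable_imp_null_set_lborel)
  from AE_not_in[OF this] show ?thesis
    by (subst AE_restrict_space_iff) auto
qed

text \<open>The left limit of \<open>F\<close> at \<open>Q s\<close> is at most s, while
  \<open>F (Q s)\<close> is at least s. Together these bracket s even when \<open>Q s\<close> is an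
  atom.\<close>

lemma prob_less_Q:
  assumes "0 < s" "s < 1"
  shows "measure M {w\<in>space M. X 1 w < Q s} \<le> s"
proof -
  have "X 1 -` {..<Q s} \<inter> space M = {w\<in>space M. X 1 w < Q s}" by auto
  then have "measure M {w\<in>space M. X 1 w < Q s} = measure (distr M borel (X 1)) {..<Q s}"
    by (subst measure_distr) (simp_all only: rv1 lessThan_borel)
  also have "\<dots> = measure unit_interval (Q -` {..<Q s} \<inter> space unit_interval)"
    unfolding distr_Q[symmetric] by (subst measure_distr) auto
  also have "\<dots> = measure lborel (Q -` {..<Q s} \<inter> space unit_interval)"
    by (rule measure_restrict_space) auto
  also have "\<dots> \<le> measure lborel {0<..<s}"
  proof (rule measure_mono_fmeasurable)
    show "Q -` {..<Q s} \<inter> space unit_interval \<subseteq> {0<..<s}"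
    proof
      fix t assume "t \<in> Q -` {..<Q s} \<inter> space unit_interval"
      then show "t \<in> {0<..<s}" using Q_mono[of s t] assms by (cases "t < s") auto
    qed
    have "Q -` {..<Q s} \<inter> space unit_interval \<in> sets unit_interval"
      by (rule measurable_sets[OF Q_measurable]) simp
    then show "Q -` {..<Q s} \<inter> space unit_interval \<in> sets lborel"
      by (simp add: sets_restrict_space_iff)
  qed (use assms in \<open>auto simp: fmeasurable_def\<close>)
  finally show ?thesis using assms by simp
qed

lemma empirical_measure_tendsto:
  assumes B: "{x. P x} \<in> sets borel"
  shows "AE w in M. (\<lambda>n. card {j\<in>{1..n}. P (X j w)} / n) \<longlonglongrightarrow> measure M {w\<in>space M. P (X 1 w)}"
proof -
  have [measurable]: "indicator {x. P x} \<in> borel_measurable borel" using B by simp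
  have "integrable M (\<lambda>w. indicator {x. P x} (X 1 w) :: real)"
    by (rule integrable_const_bound[where B=1]) (use rv1 in auto)
  from strong_law[OF _ _ this] have "AE w in M. (\<lambda>n. (\<Sum>j=1..n. indicator {x. P x} (X j w)) / n)
      \<longlonglongrightarrow> expectation (\<lambda>w. indicator {x. P x} (X 1 w))" by simp
  moreover have "(\<Sum>j=1..n. indicator {x. P x} (X j w)) = real (card {j\<in>{1..n}. P (X j w)})" for n w
  proof -
    have "(\<Sum>j=1..n. indicator {x. P x} (X j w) :: real) = (\<Sum>j\<in>{1..n}. of_bool (P (X j w)))"
      by (intro sum.cong) (auto simp: indicator_def)
    moreover have "{1..n} \<inter> {j. P (X j w)} = {j\<in>{1..n}. P (X j w)}" by auto
    ultimately show ?thesis by simp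
  qed
  moreover have "expectation (\<lambda>w. indicator {x. P x} (X 1 w)) = measure M {w\<in>space M. P (X 1 w)}"
  proof -
    have "X 1 -` {x. P x} \<inter> space M = {w\<in>space M. P (X 1 w)}" by auto
    moreover have "expectation (\<lambda>w. indicator {x. P x} (X 1 w)) = measure (distr M borel (X 1)) {x. P x}"
      using integral_distr[OF rv1, of "indicator {x. P x} :: real \<Rightarrow> real"] B by simp
    ultimately show ?thesis using measure_distr[OF rv1 B] by simp
  qed
  ultimately show ?thesis by simp
qed

text \<open>The value h (Q t) is attained by G at F (Q t), although F (Q t) may exceed t: on the
  interval between them Q, hence G, is constant.\<close>
lemma AE_eq_continuous_version:
  fixes h G :: "real \<Rightarrow> real"
  assumes h [measurable]: "h \<in> borel_measurable borel" and G: "continuous_on UNIV G"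
    and GQ: "\<And>t. 0 < t \<Longrightarrow> t < 1 \<Longrightarrow> G t = h (Q t)"
  shows "AE w in M. \<forall>j\<ge>1. h (X j w) = G (F (X j w))"
proof -
  have [measurable]: "G \<in> borel_measurable borel" by (rule borel_measurable_continuous_onI[OF G])
  have meas: "{x. h x = G (F x)} \<in> sets borel" by measurable
  have "h (Q t) = G (F (Q t))" if t: "0 < t" "t < 1" for t
  proof -
    have ge: "t \<le> F (Q t)" using Q_le_iff[OF t, of "Q t"] by simp
    have eq: "G s = h (Q t)" if s: "t \<le> s" "s \<le> F (Q t)" "s < 1" for s
    proof -
      have "Q s \<le> Q t" using Q_le_iff[of s "Q t"] s t by simp
      moreover have "Q t \<le> Q s" using Q_mono[of t s] s t by simp
      ultimately show ?thesis using GQ[of s] s t by simp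
    qed
    show ?thesis
    proof (cases "F (Q t) < 1")
      case True
      then show ?thesis using eq[of "F (Q t)"] ge by simp
    next
      \<comment> \<open>The level 1 lies outside the range of \<open>GQ\<close>; the value of G
        there is recovered by continuity from the left.\<close>
      case False
      then have F1: "F (Q t) = 1" using F_bounds[of "Q t"] by simp
      have "(G \<longlongrightarrow> G 1) (at_left 1)"
        using G by (auto simp: continuous_on_def intro: tendsto_within_subset)
      moreover have "\<forall>\<^sub>F s in at_left 1. G s = h (Q t)"
        using eventually_at_left_real[OF t(2)] by eventually_elim (rule eq, auto simp: F1)
      then have "(G \<longlongrightarrow> h (Q t)) (at_left 1)" by (rule tendsto_eventually)
      ultimately have "G 1 = h (Q t)" by (intro tendsto_unique[OF trivial_limit_at_left_real])
      then show ?thesis by (simp add: F1)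
    qed
  qed
  from AE_from_Q[OF meas this] have "AE w in M. h (X 1 w) = G (F (X 1 w))" .
  from AE_ident[OF this meas] show ?thesis
    by (subst AE_all_countable) (auto intro: AE_impI)
qed

text \<open>For every t some s within 2/m of t satisfies h x = G s, where x is the order statistic;
  uniform continuity of G on [0,1] then finishes. Normally s = \<open>F x\<close>; at an atom
  \<open>F x\<close> may be far above t and a grid level replaces it.\<close>

lemma uniform_convergence_ord_stat:
  fixes h G :: "real \<Rightarrow> real"
  assumes h: "h \<in> borel_measurable borel" and G: "continuous_on UNIV G"
    and GQ: "\<And>t. 0 < t \<Longrightarrow> t < 1 \<Longrightarrow> G t = h (Q t)"
  shows "AE w in M. \<forall>e>0. \<forall>\<^sub>F n in sequentially. \<forall>t\<in>{0<..<1}. \<bar>h (ord_stat X n (cell n t) w) - h (Q t)\<bar> < e"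
proof -
  let ?q = "\<lambda>l m. Q (real l / real m)"
  \<comment> \<open>The null set is fixed before the accuracy, for all grid quantiles at once; the
    open half-lines follow separately, as atoms distinguish the two limits.\<close>
  have "AE w in M. \<forall>l m. (\<lambda>n. card {j\<in>{1..n}. X j w \<le> ?q l m} / n) \<longlonglongrightarrow> measure M {w\<in>space M. X 1 w \<le> ?q l m}"
    unfolding AE_all_countable by (intro allI empirical_measure_tendsto) auto
  moreover have "AE w in M. \<forall>l m. (\<lambda>n. card {j\<in>{1..n}. X j w < ?q l m} / n) \<longlonglongrightarrow> measure M {w\<in>space M. X 1 w < ?q l m}"
    unfolding AE_all_countable by (intro allI empirical_measure_tendsto) auto
  moreover have "AE w in M. \<forall>j\<ge>1. h (X j w) = G (F (X j w))"
    by (rule AE_eq_continuous_version[OF h G GQ])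
  ultimately show ?thesis
  proof eventually_elim
    case (elim w)
    show ?case
    proof (intro allI impI)
      fix e :: real assume e: "e > 0"
      have "uniformly_continuous_on {0..1} G"
        by (rule compact_uniformly_continuous) (auto intro: continuous_on_subset[OF G])
      then obtain d where d: "d > 0" "\<And>s t. s \<in> {0..1} \<Longrightarrow> t \<in> {0..1} \<Longrightarrow> \<bar>s - t\<bar> < d \<Longrightarrow> \<bar>G s - G t\<bar> < e"
        unfolding uniformly_continuous_on_def dist_real_def using e by metis
      \<comment> \<open>One mesh 1/m is spent on rounding t to the grid and one on the error of the
        empirical distribution.\<close>
      obtain m :: nat where m: "2 / d < m" using reals_Archimedean2 by blast
      have m0: "real m > 0" using m d(1) by (meson divide_pos_pos less_trans zero_less_numeral)
      have md: "2 / real m < d" using m d(1) m0 by (simp add: field_simps)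
      have ev1: "\<forall>\<^sub>F n in sequentially. \<forall>l\<in>{1..<m}. real l / m - 1 / m < card {j\<in>{1..n}. X j w \<le> ?q l m} / n"
      proof (rule eventually_ball_finite)
        show "\<forall>l\<in>{1..<m}. \<forall>\<^sub>F n in sequentially. real l / m - 1 / m < card {j\<in>{1..n}. X j w \<le> ?q l m} / n"
        proof
          fix l assume l: "l \<in> {1..<m}"
          have "real l / m \<le> F (?q l m)" using Q_le_iff[of "real l / m" "?q l m"] l m0 by simp
          then have "real l / m - 1 / m < F (?q l m)" using m0 by (smt (verit) divide_pos_pos)
          then show "\<forall>\<^sub>F n in sequentially. real l / m - 1 / m < card {j\<in>{1..n}. X j w \<le> ?q l m} / n"
            using elim(1) unfolding F_def by (intro order_tendstoD(1)) auto
        qed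
      qed simp
      have ev2: "\<forall>\<^sub>F n in sequentially. \<forall>l\<in>{1..<m}. card {j\<in>{1..n}. X j w < ?q l m} / n < real l / m + 1 / m"
      proof (rule eventually_ball_finite)
        show "\<forall>l\<in>{1..<m}. \<forall>\<^sub>F n in sequentially. card {j\<in>{1..n}. X j w < ?q l m} / n < real l / m + 1 / m"
        proof
          fix l assume l: "l \<in> {1..<m}"
          have "measure M {w\<in>space M. X 1 w < ?q l m} \<le> real l / m"
            using l m0 by (intro prob_less_Q) auto
          then have "measure M {w\<in>space M. X 1 w < ?q l m} < real l / m + 1 / m" using m0 by (smt (verit) divide_pos_pos)
          then show "\<forall>\<^sub>F n in sequentially. card {j\<in>{1..n}. X j w < ?q l m} / n < real l / m + 1 / m"
            using elim(2) by (intro order_tendstoD(2)) auto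
        qed
      qed simp
      show "\<forall>\<^sub>F n in sequentially. \<forall>t\<in>{0<..<1}. \<bar>h (ord_stat X n (cell n t) w) - h (Q t)\<bar> < e"
        using ev1 ev2 eventually_ge_at_top[of 1]
      proof eventually_elim
        case (elim n)
        note E1 = elim(1) and E2 = elim(2)
        have n: "n \<ge> 1" "real n > 0" using elim(3) by auto
        show ?case
        proof
          fix t :: real assume "t \<in> {0<..<1}"
          then have t: "0 < t" "t < 1" by auto
          define i where "i = cell n t"
          have i: "1 \<le> i" "i \<le> n" "t * n \<le> i" "i < t * n + 1"
            using cell_bounds[OF t n(1)] by (auto simp: i_def)
          define x where "x = ord_stat X n i w"
          obtain j where j: "j \<ge> 1" "x = X j w"
            using ord_stat_mem[OF i(1,2), of X w] by (auto simp: x_def)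
          have hx: "h x = G (F x)" using \<open>\<forall>j\<ge>1. h (X j w) = G (F (X j w))\<close> j by simp
          have low: "t - 2 / m \<le> F x"
          proof (cases "t * m < 2")
            case True
            then have "t - 2 / m \<le> 0" using m0 by (simp add: field_simps)
            then show ?thesis using F_bounds(1)[of x] by linarith
          next
            case False
            \<comment> \<open>The largest grid index with l / m <= t - 1 / m. The reserve absorbs
              the empirical error, so fewer than t * n observations lie strictly below this grid
              quantile, and x is not among them.\<close>
            define l where "l = nat \<lfloor>t * m - 1\<rfloor>"
            have lr: "real l \<le> t * m - 1" "t * m - 2 < real l" "l \<ge> 1"
              using False unfolding l_def by linarith+
            have "t * m < 1 * real m" using t m0 by (intro mult_strict_right_mono) auto
            then have lm: "l \<in> {1..<m}" using lr by auto
            have "card {j\<in>{1..n}. X j w < ?q l m} / n < real l / m + 1 / m" using E2 lm by blast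
            also have "\<dots> = (real l + 1) / m" by (simp add: add_divide_distrib)
            also have "\<dots> \<le> t" using lr m0 by (simp add: field_simps)
            finally have "card {j\<in>{1..n}. X j w < ?q l m} < t * n" using n by (simp add: field_simps)
            then have "\<not> i \<le> card {j\<in>{1..n}. X j w < ?q l m}" using i(3) by linarith
            then have "\<not> x < ?q l m"
              unfolding x_def using ord_stat_downward_closed_iff[of "\<lambda>x. x < ?q l m" i n X w] i by auto
            then have "real l / m \<le> F x" using Q_le_iff[of "real l / m" x] lm m0 by auto
            moreover have "t - 2 / m \<le> real l / m"
            proof -
              have "t - 2 / m = (t * m - 2) / m" using m0 by (simp add: field_simps)
              also have "\<dots> \<le> real l / m" using lr m0 by (intro divide_right_mono) auto
              finally show ?thesis .
            qed
            ultimately show ?thesis by linarith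
          qed
          have "\<exists>s. h x = G s \<and> t - 2 / m \<le> s \<and> s \<le> t + 2 / m \<and> 0 \<le> s \<and> s \<le> 1"
          \<comment> \<open>Near the right end no grid level is available with a mesh to spare above
            t, but there \<open>F x <= 1\<close> is close enough.\<close>
          proof (cases "t * m + 2 > m")
            case True
            then have "t + 2 / m \<ge> 1" using m0 by (simp add: field_simps)
            then show ?thesis using hx low F_bounds[of x] by (intro exI[of _ "F x"]) auto
          next
            case False
            define l where "l = nat \<lceil>t * m + 1\<rceil>"
            have "t * m > 0" using t m0 by simp
            then have lr: "real l \<ge> t * m + 1" "real l < t * m + 2" "l \<ge> 1"
              unfolding l_def by linarith+
            then have lm: "l \<in> {1..<m}" using False by auto
            have l1: "0 < real l / m" "real l / m < 1" "t \<le> real l / m" "real l / m \<le> t + 2 / m"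
              using lr lm m0 by (auto simp: field_simps)
            have "t \<le> (real l - 1) / m" using lr m0 by (simp add: field_simps)
            also have "\<dots> = real l / m - 1 / m" by (simp add: diff_divide_distrib)
            also have "\<dots> < card {j\<in>{1..n}. X j w \<le> ?q l m} / n" using E1 lm by blast
            finally have "t * n < card {j\<in>{1..n}. X j w \<le> ?q l m}" using n by (simp add: field_simps)
            then have "i \<le> card {j\<in>{1..n}. X j w \<le> ?q l m}" using i(4) by linarith
            then have xq: "x \<le> ?q l m"
              unfolding x_def using ord_stat_downward_closed_iff[of "\<lambda>x. x \<le> ?q l m" i n X w] i by auto
            show ?thesis
            \<comment> \<open>Equality is the case of a possible atom, where the level l / m gives
              the same value of h. Strictly below the grid quantile, \<open>F x\<close> is less than
              l / m.\<close>
            proof (cases "x = ?q l m")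
              case True
              then have "h x = G (real l / m)" using GQ[of "real l / m"] l1 by simp
              moreover have "t - 2 / m \<le> real l / m"
                using l1(3) m0 by (smt (verit) divide_pos_pos)
              ultimately show ?thesis using l1 by (intro exI[of _ "real l / m"]) auto
            next
              case False
              then have "F x < real l / m" using Q_le_iff[of "real l / m" x] l1 xq by auto
              then show ?thesis using hx low F_bounds[of x] l1 by (intro exI[of _ "F x"]) auto
            qed
          qed
          then obtain s where s: "h x = G s" "t - 2 / m \<le> s" "s \<le> t + 2 / m" "0 \<le> s" "s \<le> 1" by blast
          then have "\<bar>s - t\<bar> < d" using md by linarith
          then have "\<bar>G s - G t\<bar> < e" using s t by (intro d(2)) auto
          then show "\<bar>h (ord_stat X n (cell n t) w) - h (Q t)\<bar> < e"
            using s(1) GQ[OF t] by (simp add: x_def i_def)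
        qed
      qed
    qed
  qed
qed

text \<open>Rational points suffice, so the exceptional null set does not depend on t. Continuity of
  \<open>Q\<close> enters only from above: a point y > Q t gives merely \<open>F y >= t\<close>,
  with equality if \<open>F\<close> is flat there.\<close>

lemma ord_stat_tendsto_quantile:
  assumes F: "\<And>y. y \<in> \<rat> \<Longrightarrow> (\<lambda>n. card {j\<in>{1..n}. X j w \<le> y} / n) \<longlonglongrightarrow> F y"
    and t: "0 < t" "t < 1" and cont: "isCont Q t"
  shows "(\<lambda>n. ord_stat X n (cell n t) w) \<longlonglongrightarrow> Q t"
proof (rule order_tendstoI)
  fix a assume "a < Q t"
  then obtain y where y: "y \<in> \<rat>" "a < y" "y < Q t" using Rats_dense_in_real by blast
  then have "F y < t" using Q_le_iff[OF t, of y] by auto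
  then have "\<forall>\<^sub>F n in sequentially. card {j\<in>{1..n}. X j w \<le> y} / n < t"
    by (rule order_tendstoD(2)[OF F[OF y(1)]])
  then show "\<forall>\<^sub>F n in sequentially. a < ord_stat X n (cell n t) w"
    using eventually_ge_at_top[of 1]
  proof eventually_elim
    case (elim n)
    note b = cell_bounds[OF t elim(2)]
    have "card {j\<in>{1..n}. X j w \<le> y} < t * n" using elim by (simp add: field_simps)
    then have "\<not> cell n t \<le> card {j\<in>{1..n}. X j w \<le> y}" using b by linarith
    then have "\<not> ord_stat X n (cell n t) w \<le> y"
      using ord_stat_downward_closed_iff[of "\<lambda>x. x \<le> y" "cell n t" n X w] b by auto
    then show ?case using y by simp
  qed
next
  fix a assume a: "Q t < a"
  \<comment> \<open>Moving to a level s > t with \<open>Q s < a\<close> makes the inequality t < F y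
    strict.\<close>
  have "(Q \<longlongrightarrow> Q t) (at_right t)"
    using cont by (auto simp: isCont_def intro: tendsto_within_subset)
  from order_tendstoD(2)[OF this a] eventually_at_right_real[OF t(2)]
  have "\<forall>\<^sub>F s in at_right t. Q s < a \<and> s \<in> {t<..<1}" by eventually_elim auto
  then obtain s where s: "Q s < a" "t < s" "s < 1"
    using eventually_happens'[OF trivial_limit_at_right_real] by fastforce
  obtain y where y: "y \<in> \<rat>" "Q s < y" "y < a" using Rats_dense_in_real[OF s(1)] by blast
  then have "t < F y" using Q_le_iff[of s y] s t by auto
  then have "\<forall>\<^sub>F n in sequentially. t < card {j\<in>{1..n}. X j w \<le> y} / n"
    by (rule order_tendstoD(1)[OF F[OF y(1)]])
  then show "\<forall>\<^sub>F n in sequentially. ord_stat X n (cell n t) w < a"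
    using eventually_ge_at_top[of 1]
  proof eventually_elim
    case (elim n)
    note b = cell_bounds[OF t elim(2)]
    have "t * n < card {j\<in>{1..n}. X j w \<le> y}" using elim by (simp add: field_simps)
    then have "cell n t \<le> card {j\<in>{1..n}. X j w \<le> y}" using b by linarith
    then have "ord_stat X n (cell n t) w \<le> y"
      using ord_stat_downward_closed_iff[of "\<lambda>x. x \<le> y" "cell n t" n X w] b by auto
    then show ?case using y by simp
  qed
qed

lemma Lp_convergence_ord_stat:
  fixes h :: "real \<Rightarrow> real"
  assumes h [measurable]: "h \<in> borel_measurable borel" and p: "p \<ge> 1"
    and hp: "integrable M (\<lambda>w. \<bar>h (X 1 w)\<bar> powr p)"
  shows "AE w in M. (\<lambda>n. integral\<^sup>L unit_interval (\<lambda>t. \<bar>h (ord_stat X n (cell n t) w) - h (Q t)\<bar> powr p)) \<longlonglongrightarrow> 0"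
proof -
  \<comment> \<open>A countable sequence of approximants, so that the null sets from the strong law
    can be united before the tolerance e is chosen.\<close>
  have "\<exists>g B. continuous_on UNIV g \<and> (\<forall>x. \<bar>g x\<bar> \<le> B) \<and>
      (\<integral>x. \<bar>h x - g x\<bar> powr p \<partial>distr M borel (X 1)) < inverse (real (Suc k))" for k
  proof (rule approx_Lp_continuous[OF law.finite_measure_axioms _ p h])
    show "integrable (distr M borel (X 1)) (\<lambda>x. \<bar>h x\<bar> powr p)"
      using hp by (subst integrable_law_iff) auto
  qed auto
  then obtain g B where g: "\<And>k. continuous_on UNIV (g k)" "\<And>k x. \<bar>g k x\<bar> \<le> B k"
      "\<And>k. (\<integral>x. \<bar>h x - g k x\<bar> powr p \<partial>distr M borel (X 1)) < inverse (real (Suc k))"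
    by metis
  have gm [measurable]: "g k \<in> borel_measurable borel" for k by (rule borel_measurable_continuous_onI[OF g(1)])
  define A where "A k = expectation (\<lambda>w. \<bar>h (X 1 w) - g k (X 1 w)\<bar> powr p)" for k
  have A: "A k < inverse (real (Suc k))" for k
    using g(3)[of k] integral_distr[OF rv1, of "\<lambda>x. \<bar>h x - g k x\<bar> powr p"] by (simp add: A_def)
  have Ai: "integrable M (\<lambda>w. \<bar>h (X 1 w) - g k (X 1 w)\<bar> powr p)" for k
  proof (rule Bochner_Integration.integrable_bound)
    show "integrable M (\<lambda>w. 3 powr p * (\<bar>h (X 1 w)\<bar> powr p + B k powr p + 0 powr p))"
      using hp by simp
    show "(\<lambda>w. \<bar>h (X 1 w) - g k (X 1 w)\<bar> powr p) \<in> borel_measurable M" using rv1 by measurable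
    show "AE w in M. norm (\<bar>h (X 1 w) - g k (X 1 w)\<bar> powr p) \<le> norm (3 powr p * (\<bar>h (X 1 w)\<bar> powr p + B k powr p + 0 powr p))"
    proof (rule AE_I2)
      fix w
      have "\<bar>h (X 1 w) - g k (X 1 w)\<bar> powr p \<le> (\<bar>h (X 1 w)\<bar> + B k + 0) powr p"
        using p g(2)[of k "X 1 w"] by (intro powr_mono2) auto
      also have "\<dots> \<le> 3 powr p * (\<bar>h (X 1 w)\<bar> powr p + B k powr p + 0 powr p)"
        using p g(2)[of k 0] by (intro powr_sum3_le) auto
      finally show "norm (\<bar>h (X 1 w) - g k (X 1 w)\<bar> powr p) \<le> norm (3 powr p * (\<bar>h (X 1 w)\<bar> powr p + B k powr p + 0 powr p))"
        by simp
    qed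
  qed
  have "AE w in M. \<forall>k. (\<lambda>n. (\<Sum>j=1..n. \<bar>h (X j w) - g k (X j w)\<bar> powr p) / n) \<longlonglongrightarrow> A k"
    unfolding AE_all_countable A_def by (intro allI strong_law Ai) auto
  moreover have "AE w in M. \<forall>y\<in>\<rat>. (\<lambda>n. card {j\<in>{1..n}. X j w \<le> y} / n) \<longlonglongrightarrow> F y"
    unfolding F_def by (subst AE_ball_countable[OF countable_rat]) (intro ballI empirical_measure_tendsto, simp)
  ultimately show ?thesis
  proof eventually_elim
    case (elim w)
    let ?x = "\<lambda>n t. ord_stat X n (cell n t) w"
    have xm [measurable]: "?x n \<in> borel_measurable unit_interval" for n by (rule cell_comp_measurable)
    have middle: "(\<lambda>n. integral\<^sup>L unit_interval (\<lambda>t. \<bar>g k (?x n t) - g k (Q t)\<bar> powr p)) \<longlonglongrightarrow> 0" for k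
    proof -
      have "(\<lambda>n. integral\<^sup>L unit_interval (\<lambda>t. \<bar>g k (?x n t) - g k (Q t)\<bar> powr p)) \<longlonglongrightarrow> integral\<^sup>L unit_interval (\<lambda>t. 0)"
      proof (rule integral_dominated_convergence[where w="\<lambda>_. (2 * B k) powr p"])
        show "AE t in unit_interval. (\<lambda>n. \<bar>g k (?x n t) - g k (Q t)\<bar> powr p) \<longlonglongrightarrow> 0"
          using AE_isCont_Q AE_space
        proof eventually_elim
          case (elim t)
          then have t: "0 < t" "t < 1" by auto
          have "(\<lambda>n. ?x n t) \<longlonglongrightarrow> Q t"
            using \<open>\<forall>y\<in>\<rat>. _ y\<close> elim(1) t by (intro ord_stat_tendsto_quantile) auto
          moreover have "isCont (g k) (Q t)" using g(1)[of k] by (simp add: continuous_on_eq_continuous_at)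
          ultimately have "(\<lambda>n. g k (?x n t)) \<longlonglongrightarrow> g k (Q t)" by (rule isCont_tendsto_compose[rotated])
          then have "(\<lambda>n. \<bar>g k (?x n t) - g k (Q t)\<bar>) \<longlonglongrightarrow> 0" by (intro tendsto_rabs_zero LIM_zero)
          from tendsto_powr'[OF this tendsto_const[of p]] show ?case using p by simp
        qed
        show "AE t in unit_interval. norm (\<bar>g k (?x n t) - g k (Q t)\<bar> powr p) \<le> (2 * B k) powr p" for n
        proof (rule AE_I2)
          fix t
          have "\<bar>g k (?x n t) - g k (Q t)\<bar> \<le> 2 * B k" using g(2)[of k "?x n t"] g(2)[of k "Q t"] by linarith
          then show "norm (\<bar>g k (?x n t) - g k (Q t)\<bar> powr p) \<le> (2 * B k) powr p"
            using p by (simp add: powr_mono2)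
        qed
      qed (use unit_interval.integrable_const in \<open>auto\<close>)
      then show ?thesis by simp
    qed
    show ?case
    proof (rule LIMSEQ_I)
      fix e :: real assume e: "e > 0"
      \<comment> \<open>Both the sample error and the population error tend to or equal
        \<open>A k\<close>; the factor 3 powr p from the three-term split is divided out
        here.\<close>
      obtain k where k: "inverse (real (Suc k)) < e / (2 * 3 powr p)"
        using reals_Archimedean[of "e / (2 * 3 powr p)"] e by auto
      let ?a = "\<lambda>n. (\<Sum>j=1..n. \<bar>h (X j w) - g k (X j w)\<bar> powr p) / n"
      let ?b = "\<lambda>n. integral\<^sup>L unit_interval (\<lambda>t. \<bar>g k (?x n t) - g k (Q t)\<bar> powr p)"
      have "(\<lambda>n. 3 powr p * (?a n + ?b n + A k)) \<longlonglongrightarrow> 3 powr p * (A k + 0 + A k)"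
        using elim(1) middle[of k] by (intro tendsto_intros) auto
      moreover have "3 powr p * (A k + 0 + A k) < e"
      proof -
        have "A k < e / (2 * 3 powr p)" using A[of k] k by linarith
        then have "A k * (2 * 3 powr p) < e" by (subst (asm) pos_less_divide_eq) auto
        then show ?thesis by (simp add: algebra_simps)
      qed
      ultimately have ev: "\<forall>\<^sub>F n in sequentially. 3 powr p * (?a n + ?b n + A k) < e"
        by (rule order_tendstoD(2))
      have "\<forall>\<^sub>F n in sequentially. norm (integral\<^sup>L unit_interval (\<lambda>t. \<bar>h (?x n t) - h (Q t)\<bar> powr p) - 0) < e"
        using ev eventually_ge_at_top[of 1]
      proof eventually_elim
        case (elim n)
        have I1: "integrable unit_interval (\<lambda>t. \<bar>h (?x n t) - g k (?x n t)\<bar> powr p)"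
          using integrable_cell[OF elim(2), of "\<lambda>i. \<bar>h (ord_stat X n i w) - g k (ord_stat X n i w)\<bar> powr p"] .
        have E1: "integral\<^sup>L unit_interval (\<lambda>t. \<bar>h (?x n t) - g k (?x n t)\<bar> powr p) = ?a n"
          using integral_cell[OF elim(2), of "\<lambda>i. \<bar>h (ord_stat X n i w) - g k (ord_stat X n i w)\<bar> powr p"]
            sum_ord_stat[of "\<lambda>x. \<bar>h x - g k x\<bar> powr p" X n w] by simp
        have I2: "integrable unit_interval (\<lambda>t. \<bar>g k (?x n t) - g k (Q t)\<bar> powr p)"
        proof (rule unit_interval.integrable_const_bound[where B="(2 * B k) powr p"], rule AE_I2)
          fix t
          have "\<bar>g k (?x n t) - g k (Q t)\<bar> \<le> 2 * B k" using g(2)[of k "?x n t"] g(2)[of k "Q t"] by linarith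
          then show "norm (\<bar>g k (?x n t) - g k (Q t)\<bar> powr p) \<le> (2 * B k) powr p"
            using p by (simp add: powr_mono2)
        qed measurable
        have I3: "integrable unit_interval (\<lambda>t. \<bar>h (Q t) - g k (Q t)\<bar> powr p)"
          using integrable_Q_iff[of "\<lambda>x. \<bar>h x - g k x\<bar> powr p"] Ai[of k] by simp
        have E3: "integral\<^sup>L unit_interval (\<lambda>t. \<bar>h (Q t) - g k (Q t)\<bar> powr p) = A k"
          using integral_Q[of "\<lambda>x. \<bar>h x - g k x\<bar> powr p"] by (simp add: A_def)
        have "integral\<^sup>L unit_interval (\<lambda>t. \<bar>h (?x n t) - h (Q t)\<bar> powr p)
           \<le> integral\<^sup>L unit_interval (\<lambda>t. 3 powr p * (\<bar>h (?x n t) - g k (?x n t)\<bar> powr p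
               + \<bar>g k (?x n t) - g k (Q t)\<bar> powr p + \<bar>h (Q t) - g k (Q t)\<bar> powr p))"
        proof (rule integral_mono')
          show "integrable unit_interval (\<lambda>t. 3 powr p * (\<bar>h (?x n t) - g k (?x n t)\<bar> powr p
               + \<bar>g k (?x n t) - g k (Q t)\<bar> powr p + \<bar>h (Q t) - g k (Q t)\<bar> powr p))"
            using I1 I2 I3 by simp
          fix t
          have "\<bar>h (?x n t) - h (Q t)\<bar> powr p \<le> (\<bar>h (?x n t) - g k (?x n t)\<bar>
               + \<bar>g k (?x n t) - g k (Q t)\<bar> + \<bar>h (Q t) - g k (Q t)\<bar>) powr p"
            using p by (intro powr_mono2) auto
          also have "\<dots> \<le> 3 powr p * (\<bar>h (?x n t) - g k (?x n t)\<bar> powr p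
               + \<bar>g k (?x n t) - g k (Q t)\<bar> powr p + \<bar>h (Q t) - g k (Q t)\<bar> powr p)"
            using p by (intro powr_sum3_le) auto
          finally show "\<bar>h (?x n t) - h (Q t)\<bar> powr p \<le> 3 powr p * (\<bar>h (?x n t) - g k (?x n t)\<bar> powr p
               + \<bar>g k (?x n t) - g k (Q t)\<bar> powr p + \<bar>h (Q t) - g k (Q t)\<bar> powr p)" .
        qed (auto intro!: mult_nonneg_nonneg add_nonneg_nonneg)
        also have "\<dots> = 3 powr p * (?a n + ?b n + A k)"
          using I1 I2 I3 by (simp add: E1 E3)
        also have "\<dots> < e" by (rule elim(1))
        finally show ?case by (simp add: Bochner_Integration.integral_nonneg)
      qed
      then show "\<exists>n0. \<forall>n\<ge>n0. norm (integral\<^sup>L unit_interval (\<lambda>t. \<bar>h (?x n t) - h (Q t)\<bar> powr p) - 0) < e"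
        unfolding eventually_sequentially .
    qed
  qed
qed

end

section \<open>L-statistics\<close>

text \<open>Young's inequality with a small parameter, replacing Hoelder's inequality: compare y with
  e * x powr (q - 1), where q = p / (p - 1).\<close>
lemma mult_le_powr_conjugate:
  fixes x y e p :: real
  assumes "x \<ge> 0" "y \<ge> 0" "e > 0" "p > 1"
  shows "x * y \<le> e * x powr (p / (p - 1)) + e powr (1 - p) * y powr p"
proof -
  define q where "q = p / (p - 1)"
  have q: "q - 1 = 1 / (p - 1)" using assms by (simp add: q_def field_simps)
  consider "x = 0" | "x > 0" "y \<le> e * x powr (q - 1)" | "x > 0" "y > e * x powr (q - 1)"
    using assms by linarith
  then have "x * y \<le> e * x powr q + e powr (1 - p) * y powr p"
  proof cases
    case 2
    then have "x * y \<le> x * (e * x powr (q - 1))" using assms by (intro mult_left_mono) auto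
    also have "\<dots> = e * (x powr 1 * x powr (q - 1))" using 2 by simp
    also have "\<dots> = e * x powr q" by (subst powr_add[symmetric]) simp
    finally show ?thesis by (simp add: add_increasing2)
  next
    case 3
    then have y: "y > 0" using assms by (smt (verit) mult_nonneg_nonneg powr_ge_zero)
    have "x powr (q - 1) < y / e" using 3 assms by (simp add: pos_less_divide_eq mult.commute)
    \<comment> \<open>Since (q - 1) * (p - 1) = 1, this power inverts the comparison and bounds x by
      a power of y / e.\<close>
    then have "(x powr (q - 1)) powr (p - 1) \<le> (y / e) powr (p - 1)"
      using assms by (intro powr_mono2) auto
    also have "(x powr (q - 1)) powr (p - 1) = x" using assms 3 by (simp add: powr_powr q)
    finally have "x * y \<le> (y / e) powr (p - 1) * y" using assms by (intro mult_right_mono) auto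
    also have "\<dots> = e powr (1 - p) * (y powr (p - 1) * y powr 1)"
      using y assms by (simp add: powr_divide powr_diff powr_minus_divide field_simps)
    also have "\<dots> = e powr (1 - p) * y powr p" by (subst powr_add[symmetric]) simp
    finally show ?thesis using assms by (simp add: add_increasing)
  qed (use assms in simp)
  then show ?thesis unfolding q_def .
qed

lemma integral_cell_abs_powr:
  assumes "n \<ge> 1"
  shows "integral\<^sup>L unit_interval (\<lambda>t. \<bar>c n (cell n t)\<bar> powr q) = C_q c q n"
  using integral_cell[OF assms, of "\<lambda>i. \<bar>c n i\<bar> powr q"] by (simp add: C_q_def)

context phi_mixing
begin

lemma L_stat_tendsto_uniform:
  fixes h G :: "real \<Rightarrow> real" and c :: "nat \<Rightarrow> nat \<Rightarrow> real"
  assumes h [measurable]: "h \<in> borel_measurable borel" and G: "continuous_on UNIV G"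
    and GQ: "\<And>t. 0 < t \<Longrightarrow> t < 1 \<Longrightarrow> G t = h (Q t)"
    and K: "\<And>n. n \<ge> 1 \<Longrightarrow> C_q c 1 n \<le> K"
  shows "AE w in M. (\<lambda>n. L_stat c h X n w - (LBINT t=0..1. c_step c n t * h (Q t))) \<longlonglongrightarrow> 0"
  using uniform_convergence_ord_stat[OF h G GQ, simplified]
proof eventually_elim
  case (elim w)
  have "bounded (G ` {0..1})"
    by (intro compact_imp_bounded compact_continuous_image) (auto intro: continuous_on_subset[OF G])
  then obtain b where b: "\<And>t. 0 \<le> t \<Longrightarrow> t \<le> 1 \<Longrightarrow> \<bar>G t\<bar> \<le> b"
    unfolding bounded_iff real_norm_def by (metis atLeastAtMost_iff imageI)
  have hQ: "\<bar>h (Q t)\<bar> \<le> b" if "0 < t" "t < 1" for t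
    using b[of t] GQ[OF that] that by simp
  have H: "integrable unit_interval (\<lambda>t. h (Q t))"
    by (rule unit_interval.integrable_const_bound[where B=b]) (use hQ in \<open>auto intro!: AE_I2\<close>)
  show ?case
  proof (rule LIMSEQ_I)
    fix r :: real assume r: "r > 0"
    have K0: "K \<ge> 0"
      using K[of 1] by (simp add: C_q_def)
    \<comment> \<open>\<open>K + 1\<close> in place of \<open>K\<close> allows for K = 0.\<close>
    define e where "e = r / (K + 1)"
    have e: "e > 0" "e * K < r" using r K0 by (auto simp: e_def field_simps)
    have "\<forall>\<^sub>F n in sequentially. \<forall>t\<in>{0<..<1}. \<bar>h (ord_stat X n (cell n t) w) - h (Q t)\<bar> < e"
      using elim e by auto
    then have "\<forall>\<^sub>F n in sequentially. norm (L_stat c h X n w - (LBINT t=0..1. c_step c n t * h (Q t)) - 0) < r"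
      using eventually_ge_at_top[of 1]
    proof eventually_elim
      case (elim n)
      have D: "integrable unit_interval (\<lambda>t. h (ord_stat X n (cell n t) w) - h (Q t))"
        using integrable_cell[OF elim(2), of "\<lambda>i. h (ord_stat X n i w)"] H by auto
      have "norm (L_stat c h X n w - (LBINT t=0..1. c_step c n t * h (Q t)) - 0)
          = \<bar>integral\<^sup>L unit_interval (\<lambda>t. c n (cell n t) * (h (ord_stat X n (cell n t) w) - h (Q t)))\<bar>"
        by (simp add: L_stat_minus_integral[OF elim(2) H])
      also have "\<dots> \<le> integral\<^sup>L unit_interval (\<lambda>t. \<bar>c n (cell n t) * (h (ord_stat X n (cell n t) w) - h (Q t))\<bar>)"
        by (rule integral_abs_bound)
      also have "\<dots> \<le> integral\<^sup>L unit_interval (\<lambda>t. e * \<bar>c n (cell n t)\<bar> powr 1)"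
      proof (rule integral_mono)
        show "integrable unit_interval (\<lambda>t. \<bar>c n (cell n t) * (h (ord_stat X n (cell n t) w) - h (Q t))\<bar>)"
          by (intro integrable_abs integrable_cell_mult[OF elim(2) D])
        show "integrable unit_interval (\<lambda>t. e * \<bar>c n (cell n t)\<bar> powr 1)"
          using integrable_cell[OF elim(2), of "\<lambda>i. e * \<bar>c n i\<bar> powr 1"] .
        fix t assume "t \<in> space unit_interval"
        then have "\<bar>h (ord_stat X n (cell n t) w) - h (Q t)\<bar> \<le> e" using elim(1) by (auto intro: less_imp_le)
        then show "\<bar>c n (cell n t) * (h (ord_stat X n (cell n t) w) - h (Q t))\<bar> \<le> e * \<bar>c n (cell n t)\<bar> powr 1"
          by (simp add: abs_mult mult.commute[of e] mult_left_mono)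
      qed
      also have "\<dots> = e * C_q c 1 n"
        unfolding integral_cell_abs_powr[OF elim(2), symmetric] by simp
      also have "\<dots> \<le> e * K" using e K[OF elim(2)] by (intro mult_left_mono) auto
      also have "\<dots> < r" by (rule e(2))
      finally show ?case .
    qed
    then show "\<exists>n0. \<forall>n\<ge>n0. norm (L_stat c h X n w - (LBINT t=0..1. c_step c n t * h (Q t)) - 0) < r"
      unfolding eventually_sequentially .
  qed
qed

text \<open>In Young's inequality the weights contribute at most e * K uniformly in n. So e is fixed
  first to make this small, and then n is taken large to kill the p-norm term, whatever its factor e
  powr (1 - p).\<close>

lemma L_stat_tendsto_Lp:
  fixes h :: "real \<Rightarrow> real" and c :: "nat \<Rightarrow> nat \<Rightarrow> real"
  assumes h [measurable]: "h \<in> borel_measurable borel" and p: "p \<ge> 1"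
    and hp: "integrable M (\<lambda>w. \<bar>h (X 1 w)\<bar> powr p)"
    and K: "if p = 1 then \<forall>n\<ge>1. C_inf c n \<le> K else \<forall>n\<ge>1. C_q c (p / (p - 1)) n \<le> K"
  shows "AE w in M. (\<lambda>n. L_stat c h X n w - (LBINT t=0..1. c_step c n t * h (Q t))) \<longlonglongrightarrow> 0"
  using Lp_convergence_ord_stat[OF h p hp]
proof eventually_elim
  case (elim w)
  let ?d = "\<lambda>n t. h (ord_stat X n (cell n t) w) - h (Q t)"
  have HP: "integrable unit_interval (\<lambda>t. \<bar>h (Q t)\<bar> powr p)"
    using integrable_Q_iff[of "\<lambda>x. \<bar>h x\<bar> powr p"] hp by simp
  have H: "integrable unit_interval (\<lambda>t. h (Q t))"
  proof (rule Bochner_Integration.integrable_bound)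
    show "integrable unit_interval (\<lambda>t. 1 + \<bar>h (Q t)\<bar> powr p)" using HP by simp
    show "AE t in unit_interval. norm (h (Q t)) \<le> norm (1 + \<bar>h (Q t)\<bar> powr p)"
    proof (rule AE_I2)
      fix t
      have "\<bar>h (Q t)\<bar> \<le> 1 + \<bar>h (Q t)\<bar> powr p"
      proof (cases "\<bar>h (Q t)\<bar> \<le> 1")
        case False
        then have "\<bar>h (Q t)\<bar> powr 1 \<le> \<bar>h (Q t)\<bar> powr p" using p by (intro powr_mono) auto
        then show ?thesis using False by simp
      qed (simp add: add_increasing2)
      then show "norm (h (Q t)) \<le> norm (1 + \<bar>h (Q t)\<bar> powr p)" by simp
    qed
  qed measurable
  have D: "integrable unit_interval (?d n)" if n: "n \<ge> 1" for n
    using integrable_cell[OF n, of "\<lambda>i. h (ord_stat X n i w)"] H by auto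
  have DP: "integrable unit_interval (\<lambda>t. \<bar>?d n t\<bar> powr p)" if n: "n \<ge> 1" for n
  proof (rule Bochner_Integration.integrable_bound)
    show "integrable unit_interval (\<lambda>t. 3 powr p * (\<bar>h (ord_stat X n (cell n t) w)\<bar> powr p + \<bar>h (Q t)\<bar> powr p + 0 powr p))"
      using integrable_cell[OF n, of "\<lambda>i. \<bar>h (ord_stat X n i w)\<bar> powr p"] HP by simp
    show "(\<lambda>t. \<bar>?d n t\<bar> powr p) \<in> borel_measurable unit_interval"
      using borel_measurable_integrable[OF D[OF n]] by measurable
    show "AE t in unit_interval. norm (\<bar>?d n t\<bar> powr p)
        \<le> norm (3 powr p * (\<bar>h (ord_stat X n (cell n t) w)\<bar> powr p + \<bar>h (Q t)\<bar> powr p + 0 powr p))"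
    proof (rule AE_I2)
      fix t
      have "\<bar>?d n t\<bar> powr p \<le> (\<bar>h (ord_stat X n (cell n t) w)\<bar> + \<bar>h (Q t)\<bar> + 0) powr p"
        using p by (intro powr_mono2) auto
      also have "\<dots> \<le> 3 powr p * (\<bar>h (ord_stat X n (cell n t) w)\<bar> powr p + \<bar>h (Q t)\<bar> powr p + 0 powr p)"
        using p by (intro powr_sum3_le) auto
      finally show "norm (\<bar>?d n t\<bar> powr p)
        \<le> norm (3 powr p * (\<bar>h (ord_stat X n (cell n t) w)\<bar> powr p + \<bar>h (Q t)\<bar> powr p + 0 powr p))" by simp
    qed
  qed
  have bound: "\<bar>L_stat c h X n w - (LBINT t=0..1. c_step c n t * h (Q t))\<bar>
      \<le> integral\<^sup>L unit_interval (\<lambda>t. \<bar>c n (cell n t) * ?d n t\<bar>)" if n: "n \<ge> 1" for n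
    unfolding L_stat_minus_integral[OF n H] by (rule integral_abs_bound)
  have CD: "integrable unit_interval (\<lambda>t. \<bar>c n (cell n t) * ?d n t\<bar>)" if n: "n \<ge> 1" for n
    by (intro integrable_abs integrable_cell_mult[OF n D[OF n]])
  show ?case
  \<comment> \<open>Here the conjugate exponent is infinite and the maximal weight is simply
    factored out.\<close>
  proof (cases "p = 1")
    case True
    have cK: "\<bar>c n i\<bar> \<le> K" if "i \<in> {1..n}" "n \<ge> 1" for n i
    proof -
      have "\<bar>c n i\<bar> \<le> C_inf c n" unfolding C_inf_def using that by (intro Max_ge) auto
      also have "C_inf c n \<le> K" using K True that by simp
      finally show ?thesis .
    qed
    have "\<bar>L_stat c h X n w - (LBINT t=0..1. c_step c n t * h (Q t))\<bar>
        \<le> K * integral\<^sup>L unit_interval (\<lambda>t. \<bar>?d n t\<bar> powr p)" if n: "n \<ge> 1" for n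
    proof -
      have "integral\<^sup>L unit_interval (\<lambda>t. \<bar>c n (cell n t) * ?d n t\<bar>)
          \<le> integral\<^sup>L unit_interval (\<lambda>t. K * \<bar>?d n t\<bar> powr p)"
      proof (rule integral_mono[OF CD[OF n]])
        show "integrable unit_interval (\<lambda>t. K * \<bar>?d n t\<bar> powr p)" using DP[OF n] by simp
        fix t assume "t \<in> space unit_interval"
        then have "\<bar>c n (cell n t)\<bar> \<le> K" using cell_bounds[of t n] n by (intro cK) auto
        then show "\<bar>c n (cell n t) * ?d n t\<bar> \<le> K * \<bar>?d n t\<bar> powr p"
          by (simp add: abs_mult True mult_right_mono)
      qed
      then show ?thesis using bound[OF n] by simp
    qed
    then have "\<forall>\<^sub>F n in sequentially. norm (L_stat c h X n w - (LBINT t=0..1. c_step c n t * h (Q t)))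
        \<le> K * integral\<^sup>L unit_interval (\<lambda>t. \<bar>?d n t\<bar> powr p)"
      unfolding eventually_sequentially real_norm_def by blast
    moreover have "(\<lambda>n. K * integral\<^sup>L unit_interval (\<lambda>t. \<bar>?d n t\<bar> powr p)) \<longlonglongrightarrow> 0"
      using tendsto_mult_left[OF elim, of K] by simp
    ultimately show ?thesis by (rule Lim_null_comparison)
  next
    case False
    then have p1: "p > 1" using p by simp
    define q where "q = p / (p - 1)"
    have Kq: "C_q c q n \<le> K" if "n \<ge> 1" for n using K False that by (simp add: q_def)
    have K0: "K \<ge> 0" using Kq[of 1] by (simp add: C_q_def order_trans[OF powr_ge_zero])
    show ?thesis
    proof (rule LIMSEQ_I)
      fix r :: real assume r: "r > 0"
      define e where "e = r / (K + 1)"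
      have e: "e > 0" "e * K < r" using r K0 by (auto simp: e_def field_simps)
      have "(\<lambda>n. e * K + e powr (1 - p) * integral\<^sup>L unit_interval (\<lambda>t. \<bar>?d n t\<bar> powr p)) \<longlonglongrightarrow> e * K + e powr (1 - p) * 0"
        by (intro tendsto_intros elim)
      then have "\<forall>\<^sub>F n in sequentially. e * K + e powr (1 - p) * integral\<^sup>L unit_interval (\<lambda>t. \<bar>?d n t\<bar> powr p) < r"
        using e(2) by (intro order_tendstoD(2)) auto
      then have "\<forall>\<^sub>F n in sequentially. norm (L_stat c h X n w - (LBINT t=0..1. c_step c n t * h (Q t)) - 0) < r"
        using eventually_ge_at_top[of 1]
      proof eventually_elim
        case (elim n)
        note n = elim(2)
        have CQ: "integrable unit_interval (\<lambda>t. \<bar>c n (cell n t)\<bar> powr q)"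
          using integrable_cell[OF n, of "\<lambda>i. \<bar>c n i\<bar> powr q"] .
        have "integral\<^sup>L unit_interval (\<lambda>t. \<bar>c n (cell n t) * ?d n t\<bar>)
          \<le> integral\<^sup>L unit_interval (\<lambda>t. e * \<bar>c n (cell n t)\<bar> powr q + e powr (1 - p) * \<bar>?d n t\<bar> powr p)"
        proof (rule integral_mono[OF CD[OF n]])
          show "integrable unit_interval (\<lambda>t. e * \<bar>c n (cell n t)\<bar> powr q + e powr (1 - p) * \<bar>?d n t\<bar> powr p)"
            using CQ DP[OF n] by simp
          fix t
          show "\<bar>c n (cell n t) * ?d n t\<bar> \<le> e * \<bar>c n (cell n t)\<bar> powr q + e powr (1 - p) * \<bar>?d n t\<bar> powr p"
            unfolding abs_mult q_def using e p1 by (intro mult_le_powr_conjugate) auto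
        qed
        also have "\<dots> = e * C_q c q n + e powr (1 - p) * integral\<^sup>L unit_interval (\<lambda>t. \<bar>?d n t\<bar> powr p)"
          using CQ DP[OF n] by (simp add: integral_cell_abs_powr[OF n])
        also have "\<dots> \<le> e * K + e powr (1 - p) * integral\<^sup>L unit_interval (\<lambda>t. \<bar>?d n t\<bar> powr p)"
          using e Kq[OF n] by (intro add_right_mono mult_left_mono) auto
        also have "\<dots> < r" by (rule elim(1))
        finally show ?case using bound[OF n] by simp
      qed
      then show "\<exists>n0. \<forall>n\<ge>n0. norm (L_stat c h X n w - (LBINT t=0..1. c_step c n t * h (Q t)) - 0) < r"
        unfolding eventually_sequentially .
    qed
  qed
qed

end

theorem theorem2:
  fixes M :: "'a measure" and X :: "nat \<Rightarrow> 'a \<Rightarrow> real"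
    and h :: "real \<Rightarrow> real" and c :: "nat \<Rightarrow> nat \<Rightarrow> real"
  assumes "prob_space M"
    and rv: "\<And>i. i \<ge> 1 \<Longrightarrow> X i \<in> borel_measurable M"
    and ident: "\<And>i. i \<ge> 1 \<Longrightarrow> distr M borel (X i) = distr M borel (X 1)"
    and mixing: "phi_mix M X \<longlonglongrightarrow> 0"
    and summ: "summable (\<lambda>n. sqrt (phi_mix M X (2 ^ Suc n)))"
    and hmeas: "h \<in> borel_measurable borel"
    and cond: "(\<exists>G. continuous_on {0..1} G \<and>
                   (\<forall>t\<in>{0<..<1}. G t = h (quantile (\<lambda>x. measure M {w\<in>space M. X 1 w \<le> x}) t)) \<and>
                   (\<exists>K. \<forall>n\<ge>1. C_q c 1 n \<le> K))
             \<or> (\<exists>p::real. 1 \<le> p \<and>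
                   integrable M (\<lambda>w. \<bar>h (X 1 w)\<bar> powr p) \<and>
                   (if p = 1 then (\<exists>K. \<forall>n\<ge>1. C_inf c n \<le> K)
                    else (\<exists>K. \<forall>n\<ge>1. C_q c (p / (p - 1)) n \<le> K)))"
  shows "AE w in M. (\<lambda>n. L_stat c h X n w -
            (LBINT t=0..1. c_step c n t *
               h (quantile (\<lambda>x. measure M {w\<in>space M. X 1 w \<le> x}) t))) \<longlonglongrightarrow> 0"
proof -
  interpret prob_space M by fact
  interpret phi_mixing M X
    by unfold_locales (fact rv ident summ)+
  have Q: "quantile (\<lambda>x. measure M {w\<in>space M. X 1 w \<le> x}) = Q"
    unfolding Q_def F_def ..
  have "AE w in M. (\<lambda>n. L_stat c h X n w - (LBINT t=0..1. c_step c n t * h (Q t))) \<longlonglongrightarrow> 0"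
    using cond unfolding Q
  proof (elim disjE exE conjE)
    fix G K
    assume G: "continuous_on {0..1} G" and GQ: "\<forall>t\<in>{0<..<1}. G t = h (Q t)"
      and K: "\<forall>n\<ge>1. C_q c 1 n \<le> K"
    \<comment> \<open>Constant extension beyond [0,1]: G' is continuous on the whole line, hence
      Borel, and can be composed with \<open>F\<close> without a side condition.\<close>
    define G' where "G' t = G (max 0 (min 1 t))" for t :: real
    have "continuous_on UNIV G'"
      unfolding G'_def by (rule continuous_on_compose2[OF G]) (auto intro!: continuous_intros)
    then show ?thesis
      by (rule L_stat_tendsto_uniform[OF hmeas]) (use GQ K in \<open>auto simp: G'_def\<close>)
  next
    fix p :: real
    assume p: "1 \<le> p" and hp: "integrable M (\<lambda>w. \<bar>h (X 1 w)\<bar> powr p)"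
      and K: "if p = 1 then \<exists>K. \<forall>n\<ge>1. C_inf c n \<le> K else \<exists>K. \<forall>n\<ge>1. C_q c (p / (p - 1)) n \<le> K"
    obtain K' where "if p = 1 then \<forall>n\<ge>1. C_inf c n \<le> K' else \<forall>n\<ge>1. C_q c (p / (p - 1)) n \<le> K'"
      using K by (cases "p = 1") auto
    then show ?thesis
      by (rule L_stat_tendsto_Lp[OF hmeas p hp])
  qed
  then show ?thesis unfolding Q .
qed

end
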